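(* Let $PC_n$ be a polygon chain whose stack of polygons has $k_1,\dots,k_n$ sides. Then the sandpile group $K(PC_n)$ is cyclic, of order \[\tau(PC_n)=\sum_{\mu\in M(P_n)}(-1)^{|\mu|}\prod_{v\notin V(\mu)}k_v,\] where $P_n$ is the path with vertices $1,\dots,n$ (in order), $M(P_n)$ is the set of matchings of $P_n$ (including the empty matching), and $V(\mu)$ is the set of vertices covered by $\mu$.
   Context: Polygon chain: let $(k_1,\dots,k_n)$ be integers with each $k_i\geq 2$. $PC_0$ is the path with one edge. For $1\leq i\leq n$, $PC_i$ is obtained from $PC_{i-1}$ by adding a path with $k_i-1$ edges between some pair of adjacent vertices of the path added in the construction of $PC_{i-1}$; thus $PC_n$ is a stack of $n$ polygons with $k_1,\dots,k_n$ sides. $K(G)$ denotes the sandpile group of $G$, i.e. the torsion subgroup of $\mathbb{Z}^{V(G)}/\operatorname{Im}L(G)$ with $L(G)$ the Laplacian matrix, and $\tau(G)$ is the number of spanning trees of $G$. *)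

theory Defs
  imports "HOL-Algebra.Algebra"
begin

section \<open>Undirected multigraphs\<close>

text \<open>
  Polygons with two sides create parallel edges, so edges are named and \<open>ends\<close> gives
  the set of end points of an edge (a two-element set, or a singleton for a loop).
  The values of \<open>ends\<close> outside \<open>edges\<close> are irrelevant.
\<close>

record ('v, 'e) multigraph =
  verts :: "'v set"
  edges :: "'e set"
  ends :: "'e \<Rightarrow> 'v set"

definition adjacency_rel :: "('v, 'e) multigraph \<Rightarrow> ('v \<times> 'v) set" where
  "adjacency_rel G = {(u, v). \<exists>e \<in> edges G. ends G e = {u, v}}"

definition connected_graph :: "('v, 'e) multigraph \<Rightarrow> bool" where
  "connected_graph G \<longleftrightarrow> verts G \<noteq> {} \<and>
     (\<forall>u \<in> verts G. \<forall>v \<in> verts G. (u, v) \<in> (adjacency_rel G)\<^sup>*)"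

text \<open>Cycles of length 1 are loops, cycles of length 2 are pairs of parallel edges.\<close>

definition is_cycle :: "('v, 'e) multigraph \<Rightarrow> 'v list \<Rightarrow> 'e list \<Rightarrow> bool" where
  "is_cycle G vs es \<longleftrightarrow> es \<noteq> [] \<and> length vs = length es \<and> distinct vs \<and> distinct es \<and>
     set vs \<subseteq> verts G \<and> set es \<subseteq> edges G \<and>
     (\<forall>i < length es. ends G (es ! i) = {vs ! i, vs ! (Suc i mod length es)})"

definition is_tree :: "('v, 'e) multigraph \<Rightarrow> bool" where
  "is_tree G \<longleftrightarrow> connected_graph G \<and> \<not> (\<exists>vs es. is_cycle G vs es)"

definition spanning_trees :: "('v, 'e) multigraph \<Rightarrow> 'e set set" where
  "spanning_trees G = {T. T \<subseteq> edges G \<and> is_tree (G\<lparr>edges := T\<rparr>)}"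

definition tree_number :: "('v, 'e) multigraph \<Rightarrow> nat" where
  "tree_number G = card (spanning_trees G)"

definition matchings :: "('v, 'e) multigraph \<Rightarrow> 'e set set" where
  "matchings G = {M. M \<subseteq> edges G \<and> (\<forall>e \<in> M. \<forall>f \<in> M. e \<noteq> f \<longrightarrow> ends G e \<inter> ends G f = {})}"

definition covered_verts :: "('v, 'e) multigraph \<Rightarrow> 'e set \<Rightarrow> 'v set" where
  "covered_verts G M = (\<Union>e \<in> M. ends G e)"

definition path_graph :: "nat \<Rightarrow> (nat, nat) multigraph" where
  "path_graph n = \<lparr>verts = {1..n}, edges = {1..<n}, ends = (\<lambda>i. {i, Suc i})\<rparr>"


section \<open>Polygon chains\<close>

text \<open>
  \<open>adds_path G vs es G'\<close>: \<open>G'\<close> arises from \<open>G\<close> by adding a path with vertex sequence \<open>vs\<close>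
  and edge sequence \<open>es\<close> whose first and last vertices are old, and whose interior vertices
  and edges are all new.
\<close>

definition adds_path ::
  "('v, 'e) multigraph \<Rightarrow> 'v list \<Rightarrow> 'e list \<Rightarrow> ('v, 'e) multigraph \<Rightarrow> bool" where
  "adds_path G vs es G' \<longleftrightarrow>
     (\<exists>a ws b. vs = a # ws @ [b] \<and> a \<in> verts G \<and> b \<in> verts G \<and> a \<noteq> b \<and>
        distinct ws \<and> set ws \<inter> verts G = {} \<and> verts G' = verts G \<union> set ws) \<and>
     distinct es \<and> set es \<inter> edges G = {} \<and> edges G' = edges G \<union> set es \<and>
     length vs = Suc (length es) \<and>
     (\<forall>e \<in> edges G. ends G' e = ends G e) \<and>
     (\<forall>i < length es. ends G' (es ! i) = {vs ! i, vs ! Suc i})"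

text \<open>
  \<open>polygon_chain_path k i G p\<close>: \<open>G\<close> is a possible \<open>PC\<^sub>i\<close> for the side numbers
  \<open>k 1, \<dots>, k i\<close>, and \<open>p\<close> is the vertex sequence of the path added in its last construction step.
  A new path is attached to two vertices that are consecutive on \<open>p\<close>; the two ends of \<open>p\<close>,
  although adjacent in the graph, do not qualify unless \<open>p\<close> has just one edge.
\<close>

inductive polygon_chain_path ::
  "(nat \<Rightarrow> nat) \<Rightarrow> nat \<Rightarrow> ('v, 'e) multigraph \<Rightarrow> 'v list \<Rightarrow> bool" for k where
  base: "\<lbrakk>a \<noteq> b; verts G = {a, b}; edges G = {e}; ends G e = {a, b}\<rbrakk>
     \<Longrightarrow> polygon_chain_path k 0 G [a, b]"
| step: "\<lbrakk>polygon_chain_path k i G p; 2 \<le> k (Suc i);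
      Suc j < length p; hd q = p ! j; last q = p ! Suc j;
      length es = k (Suc i) - 1; adds_path G q es G'\<rbrakk>
     \<Longrightarrow> polygon_chain_path k (Suc i) G' q"

definition polygon_chain :: "(nat \<Rightarrow> nat) \<Rightarrow> nat \<Rightarrow> ('v, 'e) multigraph \<Rightarrow> bool" where
  "polygon_chain k n G \<longleftrightarrow> (\<exists>p. polygon_chain_path k n G p)"


section \<open>The sandpile group\<close>

definition degree_of :: "('v, 'e) multigraph \<Rightarrow> 'v \<Rightarrow> nat" where
  "degree_of G v = card {e \<in> edges G. v \<in> ends G e}"

definition edge_mult :: "('v, 'e) multigraph \<Rightarrow> 'v \<Rightarrow> 'v \<Rightarrow> nat" where
  "edge_mult G u v = card {e \<in> edges G. ends G e = {u, v}}"

text \<open>A loop contributes 1 to both terms, hence nothing to the Laplacian.\<close>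

definition laplacian :: "('v, 'e) multigraph \<Rightarrow> 'v \<Rightarrow> 'v \<Rightarrow> int" where
  "laplacian G u v = (if u = v then int (degree_of G u) else 0) - int (edge_mult G u v)"

definition vertex_lattice :: "('v, 'e) multigraph \<Rightarrow> ('v \<Rightarrow> int) monoid" where
  "vertex_lattice G = product_group (verts G) (\<lambda>_. integer_group)"

definition laplacian_map :: "('v, 'e) multigraph \<Rightarrow> ('v \<Rightarrow> int) \<Rightarrow> ('v \<Rightarrow> int)" where
  "laplacian_map G x = (\<lambda>u \<in> verts G. \<Sum>v \<in> verts G. laplacian G u v * x v)"

definition laplacian_image :: "('v, 'e) multigraph \<Rightarrow> ('v \<Rightarrow> int) set" where
  "laplacian_image G = laplacian_map G ` carrier (vertex_lattice G)"

definition torsion_part :: "('a, 'b) monoid_scheme \<Rightarrow> ('a, 'b) monoid_scheme" where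
  "torsion_part A =
     A\<lparr>carrier := {x \<in> carrier A. \<exists>m::nat. 0 < m \<and> x [^]\<^bsub>A\<^esub> m = \<one>\<^bsub>A\<^esub>}\<rparr>"

definition sandpile_group :: "('v, 'e) multigraph \<Rightarrow> ('v \<Rightarrow> int) set monoid" where
  "sandpile_group G = torsion_part (vertex_lattice G Mod laplacian_image G)"

lemma comm_group_vertex_lattice: "comm_group (vertex_lattice G)"
  unfolding vertex_lattice_def
  by (rule group.group_comm_groupI)
    (auto simp: fun_eq_iff restrict_def add.commute)

lemma laplacian_map_hom:
  "laplacian_map G \<in> hom (vertex_lattice G) (vertex_lattice G)"
  by (rule homI)
    (auto simp: vertex_lattice_def laplacian_map_def algebra_simps sum.distrib restrict_def fun_eq_iff)

lemma subgroup_laplacian_image: "subgroup (laplacian_image G) (vertex_lattice G)"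
proof -
  interpret group_hom "vertex_lattice G" "vertex_lattice G" "laplacian_map G"
    using comm_group_vertex_lattice[of G] laplacian_map_hom[of G]
    by (simp add: group_hom_def group_hom_axioms_def comm_group_def)
  show ?thesis
    unfolding laplacian_image_def by (rule img_is_subgroup)
qed

lemma comm_group_torsion_part:
  assumes "comm_group A"
  shows "comm_group (torsion_part A)"
proof -
  interpret comm_group A by fact
  have "subgroup {x \<in> carrier A. \<exists>m::nat. 0 < m \<and> x [^]\<^bsub>A\<^esub> m = \<one>\<^bsub>A\<^esub>} A"
  proof (rule subgroupI)
    show "{x \<in> carrier A. \<exists>m::nat. 0 < m \<and> x [^]\<^bsub>A\<^esub> m = \<one>\<^bsub>A\<^esub>} \<noteq> {}"
      using nat_pow_one[of 1] by (metis (mono_tags, lifting) empty_iff mem_Collect_eq one_closed zero_less_one)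
  next
    fix x assume "x \<in> {x \<in> carrier A. \<exists>m::nat. 0 < m \<and> x [^]\<^bsub>A\<^esub> m = \<one>\<^bsub>A\<^esub>}"
    then show "inv\<^bsub>A\<^esub> x \<in> {x \<in> carrier A. \<exists>m::nat. 0 < m \<and> x [^]\<^bsub>A\<^esub> m = \<one>\<^bsub>A\<^esub>}"
      by (auto simp: nat_pow_inv)
  next
    fix x y assume x: "x \<in> {x \<in> carrier A. \<exists>m::nat. 0 < m \<and> x [^]\<^bsub>A\<^esub> m = \<one>\<^bsub>A\<^esub>}"
      and y: "y \<in> {x \<in> carrier A. \<exists>m::nat. 0 < m \<and> x [^]\<^bsub>A\<^esub> m = \<one>\<^bsub>A\<^esub>}"
    then obtain m n :: nat where mn: "0 < m" "x [^]\<^bsub>A\<^esub> m = \<one>\<^bsub>A\<^esub>" "0 < n" "y [^]\<^bsub>A\<^esub> n = \<one>\<^bsub>A\<^esub>" by auto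
    have "(x \<otimes>\<^bsub>A\<^esub> y) [^]\<^bsub>A\<^esub> (m * n) = x [^]\<^bsub>A\<^esub> (m * n) \<otimes>\<^bsub>A\<^esub> y [^]\<^bsub>A\<^esub> (n * m)"
      using x y by (simp add: nat_pow_distrib mult.commute)
    also have "\<dots> = \<one>\<^bsub>A\<^esub>"
      using x y mn by (simp add: nat_pow_pow[symmetric])
    finally show "x \<otimes>\<^bsub>A\<^esub> y \<in> {x \<in> carrier A. \<exists>m::nat. 0 < m \<and> x [^]\<^bsub>A\<^esub> m = \<one>\<^bsub>A\<^esub>}"
      using x y mn by (auto intro!: exI[of _ "m * n"])
  qed auto
  then show ?thesis
    unfolding torsion_part_def
    by (intro group.group_comm_groupI subgroup.subgroup_is_group is_group) (auto simp: m_comm)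
qed

lemma comm_group_sandpile_group: "comm_group (sandpile_group G)"
  unfolding sandpile_group_def
  by (intro comm_group_torsion_part comm_group.abelian_FactGroup
      comm_group_vertex_lattice subgroup_laplacian_image)

end

theory Submission
  imports Defs
begin

text \<open>
  Adding a path of \<open>m = k - 1\<close> edges between adjacent vertices \<open>u, v\<close> of \<open>G\<close> changes the number
  of spanning trees to \<open>m \<tau>(G) + \<tau>\<^sub>e(G)\<close>, where \<open>\<tau>\<^sub>e\<close> counts the trees through the edge \<open>e = uv\<close>:
  a tree omits one of the new edges, or it contains all of them and they replace \<open>e\<close>. As \<open>e\<close> lies on
  the path added before, the trees of \<open>PC\<^bsub>i\<^esub>\<close> that omit \<open>e\<close> number \<open>\<tau>(PC\<^bsub>i-1\<^esub>)\<close>; this gives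
  the three-term recursion that the matching sum satisfies too.

  For the group, let \<open>\<delta> = u - v\<close> for neighbours \<open>u, v\<close> on the last path. The potentials \<open>y\<close> with
  \<open>L y = t \<delta>\<close> realise exactly the pairs \<open>(t, y u - y v)\<close> in \<open>\<int> (\<tau>, \<tau> - \<tau>')\<close>, where \<open>\<tau>\<close> and \<open>\<tau>'\<close>
  are the tree numbers of the present and of the previous graph. This is inherited when a path is
  added, since a potential is determined along a path by the current that enters it. So \<open>\<delta>\<close>
  has order \<open>\<tau>\<close>, and it generates the elements of degree 0, which are the torsion elements.
\<close>


section \<open>The matching sum of a path\<close>

definition matching_sum :: "(nat \<Rightarrow> nat) \<Rightarrow> nat \<Rightarrow> int" where
  "matching_sum k n = (\<Sum>\<mu> \<in> matchings (path_graph n).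
     (-1) ^ card \<mu> * (\<Prod>v \<in> verts (path_graph n) - covered_verts (path_graph n) \<mu>. int (k v)))"

text \<open>The edge \<open>i\<close> joins \<open>i\<close> and \<open>Suc i\<close>, so distinct
  edges meet exactly when their indices are consecutive.\<close>

lemma matchings_path_graph:
  "matchings (path_graph n) = {M. M \<subseteq> {1..<n} \<and> (\<forall>i. i \<in> M \<longrightarrow> Suc i \<notin> M)}"
proof -
  have disj: "{i, Suc i} \<inter> {j, Suc j} = {} \<longleftrightarrow> i \<noteq> j \<and> j \<noteq> Suc i \<and> i \<noteq> Suc j" for i j :: nat
    by auto
  have "(\<forall>i \<in> M. \<forall>j \<in> M. i \<noteq> j \<longrightarrow> {i, Suc i} \<inter> {j, Suc j} = {}) \<longleftrightarrow>
      (\<forall>i. i \<in> M \<longrightarrow> Suc i \<notin> M)" for M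
    unfolding disj by (metis n_not_Suc_n)
  then show ?thesis
    by (simp add: matchings_def path_graph_def)
qed

lemma matching_sum_0 [simp]: "matching_sum k 0 = 1"
proof -
  have "matchings (path_graph 0) = {{}}"
    by (auto simp: matchings_path_graph)
  then show ?thesis
    by (simp add: matching_sum_def path_graph_def covered_verts_def)
qed

lemma matching_sum_1 [simp]: "matching_sum k (Suc 0) = int (k 1)"
proof -
  have "matchings (path_graph (Suc 0)) = {{}}"
    by (auto simp: matchings_path_graph)
  then show ?thesis
    by (simp add: matching_sum_def path_graph_def covered_verts_def)
qed

lemma matching_sum_Suc_Suc:
  "matching_sum k (Suc (Suc n)) =
     int (k (Suc (Suc n))) * matching_sum k (Suc n) - matching_sum k n"
proof -
  define cov :: "nat set \<Rightarrow> nat set" where "cov M = (\<Union>i\<in>M. {i, Suc i})" for M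
  define w where "w N M = (-1) ^ card M * (\<Prod>v \<in> {1..N} - cov M. int (k v))" for N M
  let ?M = "\<lambda>n. matchings (path_graph n)"
  have sum: "matching_sum k N = (\<Sum>M \<in> ?M N. w N M)" for N
    by (simp add: matching_sum_def w_def cov_def path_graph_def covered_verts_def)
  have fin: "finite (?M N)" for N
    by (rule finite_subset[of _ "Pow {1..<N}"]) (auto simp: matchings_path_graph)
  have split: "?M (Suc (Suc n)) = ?M (Suc n) \<union> insert (Suc n) ` ?M n"
  proof (rule Set.set_eqI, rule iffI)
    fix M assume M: "M \<in> ?M (Suc (Suc n))"
    show "M \<in> ?M (Suc n) \<union> insert (Suc n) ` ?M n"
    proof (cases "Suc n \<in> M")
      case True
      have "M - {Suc n} \<in> ?M n"
      proof -
        have "i < n" if "i \<in> M" "i \<noteq> Suc n" for i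
        proof -
          have "i < Suc (Suc n)" "i \<noteq> n"
            using M that True by (auto simp: matchings_path_graph)
          then show ?thesis using that by simp
        qed
        then have "M - {Suc n} \<subseteq> {1..<n}"
          using M unfolding matchings_path_graph by fastforce
        then show ?thesis
          using M by (auto simp: matchings_path_graph)
      qed
      moreover have "M = insert (Suc n) (M - {Suc n})"
        using True by auto
      ultimately show ?thesis by blast
    next
      case False
      have "i < Suc n" if "i \<in> M" for i
        using M that False by (auto simp: matchings_path_graph less_Suc_eq)
      then show ?thesis
        using M by (auto simp: matchings_path_graph)
    qed
  next
    fix M assume "M \<in> ?M (Suc n) \<union> insert (Suc n) ` ?M n"
    then show "M \<in> ?M (Suc (Suc n))"
      by (fastforce simp: matchings_path_graph)
  qed
  have disj: "?M (Suc n) \<inter> insert (Suc n) ` ?M n = {}"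
    by (auto simp: matchings_path_graph)
  have inj: "inj_on (insert (Suc n)) (?M n)"
  proof (rule inj_onI)
    fix A B assume "A \<in> ?M n" "B \<in> ?M n" and eq: "insert (Suc n) A = insert (Suc n) B"
    then have "Suc n \<notin> A" "Suc n \<notin> B"
      by (auto simp: matchings_path_graph)
    then show "A = B" using eq by (metis insert_ident)
  qed
  have w1: "w (Suc (Suc n)) M = int (k (Suc (Suc n))) * w (Suc n) M" if "M \<in> ?M (Suc n)" for M
  proof -
    have "Suc (Suc n) \<notin> cov M"
      using that by (auto simp: matchings_path_graph cov_def)
    then have "{1..Suc (Suc n)} - cov M = insert (Suc (Suc n)) ({1..Suc n} - cov M)"
      by auto
    then show ?thesis by (simp add: w_def)
  qed
  have w2: "w (Suc (Suc n)) (insert (Suc n) M) = - w n M" if "M \<in> ?M n" for M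
  proof -
    have "finite M" "Suc n \<notin> M"
      using that by (auto simp: matchings_path_graph intro: finite_subset)
    moreover have "{1..Suc (Suc n)} - cov (insert (Suc n) M) = {1..n} - cov M"
      using that by (auto simp: matchings_path_graph cov_def)
    ultimately show ?thesis by (simp add: w_def)
  qed
  have "matching_sum k (Suc (Suc n)) =
      (\<Sum>M \<in> ?M (Suc n). w (Suc (Suc n)) M) + (\<Sum>M \<in> insert (Suc n) ` ?M n. w (Suc (Suc n)) M)"
    unfolding sum split by (rule sum.union_disjoint) (use fin disj in auto)
  also have "(\<Sum>M \<in> insert (Suc n) ` ?M n. w (Suc (Suc n)) M) = (\<Sum>M \<in> ?M n. - w n M)"
    by (simp add: sum.reindex[OF inj] w2)
  also have "(\<Sum>M \<in> ?M (Suc n). w (Suc (Suc n)) M) =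
      int (k (Suc (Suc n))) * (\<Sum>M \<in> ?M (Suc n). w (Suc n) M)"
    by (simp add: w1 sum_distrib_left)
  finally show ?thesis
    by (simp add: sum sum_negf)
qed

section \<open>Spanning trees and cuts\<close>

definition separates :: "('v \<Rightarrow> bool) \<Rightarrow> 'v set \<Rightarrow> bool" where
  "separates P S \<longleftrightarrow> (\<exists>a \<in> S. \<exists>b \<in> S. P a \<noteq> P b)"

lemma separates_doubleton [simp]: "separates P {a, b} \<longleftrightarrow> P a \<noteq> P b"
  by (auto simp: separates_def)

lemma separates_cong: "(\<And>a. a \<in> S \<Longrightarrow> P a = Y a) \<Longrightarrow> separates P S = separates Y S"
  by (auto simp: separates_def)

text \<open>
  Connectedness and acyclicity are expressed by two-colourings of the vertices, which extend along
  an added path and restrict to the old graph, whereas walks and cycles would have to be rerouted.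
\<close>

definition cut_connected :: "('v, 'e) multigraph \<Rightarrow> bool" where
  "cut_connected G \<longleftrightarrow> (\<forall>P. (\<forall>e \<in> edges G. \<not> separates P (ends G e)) \<longrightarrow>
     (\<forall>u \<in> verts G. \<forall>v \<in> verts G. P u = P v))"

definition cut_acyclic :: "('v, 'e) multigraph \<Rightarrow> bool" where
  "cut_acyclic G \<longleftrightarrow>
     (\<forall>e \<in> edges G. \<exists>P. \<forall>f \<in> edges G. separates P (ends G f) \<longleftrightarrow> f = e)"

definition loopless_multigraph :: "('v, 'e) multigraph \<Rightarrow> bool" where
  "loopless_multigraph G \<longleftrightarrow> finite (verts G) \<and> verts G \<noteq> {} \<and> finite (edges G) \<and>
     (\<forall>e \<in> edges G. ends G e \<subseteq> verts G \<and> card (ends G e) = 2)"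

lemma loopless_endsE:
  assumes "loopless_multigraph G" "e \<in> edges G"
  obtains a b where "ends G e = {a, b}" "a \<noteq> b" "a \<in> verts G" "b \<in> verts G"
proof -
  have *: "card (ends G e) = 2" "ends G e \<subseteq> verts G"
    using assms unfolding loopless_multigraph_def by auto
  then obtain a b where "ends G e = {a, b}" "a \<noteq> b"
    unfolding card_2_iff by blast
  then show thesis using that * by simp
qed

text \<open>A colouring that separates no edge is constant along walks; conversely, reachability
  from \<open>u\<close> is such a colouring.\<close>

lemma connected_graph_iff_cut:
  assumes G: "loopless_multigraph G"
  shows "connected_graph G \<longleftrightarrow> cut_connected G"
proof
  assume conn: "connected_graph G"
  show "cut_connected G"
    unfolding cut_connected_def
  proof (intro allI impI ballI)
    fix P u v assume P: "\<forall>e\<in>edges G. \<not> separates P (ends G e)"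
      and "u \<in> verts G" "v \<in> verts G"
    then have "(u, v) \<in> (adjacency_rel G)\<^sup>*"
      using conn by (auto simp: connected_graph_def)
    then show "P u = P v"
    proof induction
      case (step y z)
      then show ?case using P by (auto simp: adjacency_rel_def)
    qed simp
  qed
next
  assume cut: "cut_connected G"
  show "connected_graph G"
    unfolding connected_graph_def
  proof (intro conjI ballI)
    show "verts G \<noteq> {}"
      using G by (simp add: loopless_multigraph_def)
    fix u v assume uv: "u \<in> verts G" "v \<in> verts G"
    let ?P = "\<lambda>w. (u, w) \<in> (adjacency_rel G)\<^sup>*"
    have "\<not> separates ?P (ends G e)" if e: "e \<in> edges G" for e
    proof -
      obtain a b where ab: "ends G e = {a, b}" using loopless_endsE[OF G e] by metis
      then have "(a, b) \<in> adjacency_rel G" "(b, a) \<in> adjacency_rel G"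
        using e by (auto simp: adjacency_rel_def insert_commute)
      then show ?thesis
        using ab by (auto intro: rtrancl_into_rtrancl)
    qed
    then have "?P u = ?P v"
      using cut uv unfolding cut_connected_def by (metis (no_types, lifting))
    then show "?P v" by simp
  qed
qed

text \<open>When a step returns to a vertex already visited, the path is cut back to that visit.
  Distinct vertices are what \<open>is_cycle\<close> asks for.\<close>

lemma rtrancl_distinct_path:
  assumes "(a, b) \<in> r\<^sup>*"
  obtains vs where "vs \<noteq> []" "distinct vs" "hd vs = a" "last vs = b"
    "\<And>i. Suc i < length vs \<Longrightarrow> (vs ! i, vs ! Suc i) \<in> r"
proof -
  have "\<exists>vs. vs \<noteq> [] \<and> distinct vs \<and> hd vs = a \<and> last vs = b \<and>
      (\<forall>i. Suc i < length vs \<longrightarrow> (vs ! i, vs ! Suc i) \<in> r)"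
    using assms
  proof induction
    case base
    show ?case by (rule exI[of _ "[a]"]) simp
  next
    case (step b c)
    then obtain vs where vs: "vs \<noteq> []" "distinct vs" "hd vs = a" "last vs = b"
      "\<forall>i. Suc i < length vs \<longrightarrow> (vs ! i, vs ! Suc i) \<in> r" by blast
    show ?case
    proof (cases "c \<in> set vs")
      case True
      then obtain j where j: "j < length vs" "vs ! j = c"
        by (auto simp: in_set_conv_nth)
      have "last (take (Suc j) vs) = c"
        using j by (simp add: take_Suc_conv_app_nth)
      then show ?thesis
        using vs j by (intro exI[of _ "take (Suc j) vs"]) simp
    next
      case False
      have "(vs @ [c]) ! Suc i = c \<and> (vs @ [c]) ! i = b" if "Suc i = length vs" for i
      proof -
        have "i = length vs - 1" using that by simp
        then show ?thesis using that vs by (simp add: nth_append last_conv_nth)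
      qed
      then have "((vs @ [c]) ! i, (vs @ [c]) ! Suc i) \<in> r" if "Suc i < length (vs @ [c])" for i
        using that vs step(2) by (cases "Suc i = length vs") (auto simp: nth_append)
      then show ?thesis
        using vs False by (intro exI[of _ "vs @ [c]"]) simp
    qed
  qed
  then show thesis using that by blast
qed

text \<open>A graph is acyclic iff every edge is a bridge. A colouring cannot change exactly once
  around a cycle; conversely, if the ends of \<open>e\<close> remain connected without
  \<open>e\<close>, a path between them closes up with \<open>e\<close> to a cycle.\<close>

lemma no_cycle_iff_cut:
  assumes G: "loopless_multigraph G"
  shows "\<not> (\<exists>vs es. is_cycle G vs es) \<longleftrightarrow> cut_acyclic G"
proof (rule iffI)
  assume ac: "cut_acyclic G"
  show "\<not> (\<exists>vs es. is_cycle G vs es)"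
  proof (intro notI, elim exE)
    fix vs es assume cyc: "is_cycle G vs es"
    let ?m = "length es"
    have m: "?m > 0" and ends: "\<And>i. i < ?m \<Longrightarrow> ends G (es ! i) = {vs ! i, vs ! (Suc i mod ?m)}"
      and es: "set es \<subseteq> edges G" "distinct es"
      using cyc by (auto simp: is_cycle_def)
    have "es ! 0 \<in> edges G" using m es by auto
    then obtain P where P: "\<And>f. f \<in> edges G \<Longrightarrow> separates P (ends G f) \<longleftrightarrow> f = es ! 0"
      using ac unfolding cut_acyclic_def by blast
    have step: "P (vs ! i) = P (vs ! (Suc i mod ?m))" if "0 < i" "i < ?m" for i
    proof -
      have "es ! i \<noteq> es ! 0"
        using that m es by (simp add: nth_eq_iff_index_eq)
      moreover have "es ! i \<in> edges G"
        using that es by auto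
      ultimately have "\<not> separates P (ends G (es ! i))"
        using P by simp
      then show ?thesis
        using ends[of i] that by simp
    qed
    \<comment> \<open>The edges other than \<open>es ! 0\<close> carry the colour from its second
      end around the cycle to its first; reducing mod \<open>?m\<close> closes the walk and covers
      cycles of length 1.\<close>
    have "Suc i \<le> ?m \<Longrightarrow> P (vs ! (1 mod ?m)) = P (vs ! (Suc i mod ?m))" for i
    proof (induction i)
      case (Suc i)
      then show ?case using step[of "Suc i"] by simp
    qed simp
    from this[of "?m - 1"] have "P (vs ! (1 mod ?m)) = P (vs ! 0)"
      using m by simp
    moreover have "separates P (ends G (es ! 0))"
      using P \<open>es ! 0 \<in> edges G\<close> by simp
    ultimately show False
      using ends[of 0] m by simp
  qed
next
  assume nc: "\<not> (\<exists>vs es. is_cycle G vs es)"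
  show "cut_acyclic G"
    unfolding cut_acyclic_def
  proof (rule ccontr)
    assume "\<not> (\<forall>e\<in>edges G. \<exists>P. \<forall>f\<in>edges G. separates P (ends G f) \<longleftrightarrow> f = e)"
    then obtain e where e: "e \<in> edges G"
      and ne: "\<And>P. \<exists>f\<in>edges G. separates P (ends G f) \<noteq> (f = e)" by blast
    obtain a b where ab: "ends G e = {a, b}" "a \<noteq> b" "b \<in> verts G"
      using loopless_endsE[OF G e] by metis
    let ?r = "adjacency_rel (G\<lparr>edges := edges G - {e}\<rparr>)"
    let ?P = "\<lambda>w. (a, w) \<in> ?r\<^sup>*"
    have nosep: "\<not> separates ?P (ends G f)" if f: "f \<in> edges G" "f \<noteq> e" for f
    proof -
      obtain c d where cd: "ends G f = {c, d}" using loopless_endsE[OF G f(1)] by metis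
      then have "(c, d) \<in> ?r" "(d, c) \<in> ?r"
        using f by (auto simp: adjacency_rel_def insert_commute)
      then show ?thesis
        using cd by (auto intro: rtrancl_into_rtrancl)
    qed
    \<comment> \<open>Otherwise reachability from \<open>a\<close> without \<open>e\<close> would be
      a colouring that separates \<open>e\<close> alone.\<close>
    have "(a, b) \<in> ?r\<^sup>*"
      using ne[of ?P] nosep ab by auto
    then obtain vs where vs: "vs \<noteq> []" "distinct vs" "hd vs = a" "last vs = b"
      "\<And>i. Suc i < length vs \<Longrightarrow> (vs ! i, vs ! Suc i) \<in> ?r"
      by (rule rtrancl_distinct_path) blast
    define m where "m = length vs"
    have a: "vs ! 0 = a" and b: "vs ! (m - 1) = b" and m: "m > 1"
    proof -
      show "vs ! 0 = a" "vs ! (m - 1) = b"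
        using vs by (auto simp: hd_conv_nth last_conv_nth m_def)
      then have "m - 1 \<noteq> 0"
        using ab(2) by metis
      then show "m > 1" by simp
    qed
    have "\<exists>f. f \<in> edges G \<and> f \<noteq> e \<and> ends G f = {vs ! i, vs ! Suc i}" if "Suc i < m" for i
      using vs(5)[of i] that by (auto simp: adjacency_rel_def m_def)
    then obtain g where g: "\<And>i. Suc i < m \<Longrightarrow> g i \<in> edges G"
        "\<And>i. Suc i < m \<Longrightarrow> g i \<noteq> e" "\<And>i. Suc i < m \<Longrightarrow> ends G (g i) = {vs ! i, vs ! Suc i}"
      by metis
    \<comment> \<open>The path has \<open>m - 1\<close> edges; \<open>e\<close> is put at the last
      index to close the cycle.\<close>
    define h where "h i = (if Suc i < m then g i else e)" for i
    have h: "h i \<in> edges G \<and> ends G (h i) = {vs ! i, vs ! (Suc i mod m)}" if "i < m" for i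
    proof (cases "Suc i < m")
      case False
      then have "Suc i = m" "i = m - 1" using that by auto
      then show ?thesis using ab a b e by (simp add: h_def insert_commute)
    qed (use g h_def in auto)
    have "i = j" if "i < m" "j < m" "h i = h j" for i j
    proof (cases "Suc i < m \<and> Suc j < m")
      case True
      then have "{vs ! i, vs ! Suc i} = {vs ! j, vs ! Suc j}"
        using that g(3) by (metis h_def)
      then show ?thesis
        using True vs(2) by (auto simp: doubleton_eq_iff nth_eq_iff_index_eq m_def)
    next
      case False
      then have "h i = e \<or> h j = e" by (auto simp: h_def)
      then have "\<not> Suc i < m \<and> \<not> Suc j < m"
        using g(2)[of i] g(2)[of j] that(3) by (auto simp: h_def split: if_splits)
      then show ?thesis using that by linarith
    qed
    then have "distinct (map h [0..<m])"
      by (auto simp: distinct_map inj_on_def)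
    moreover have "set vs \<subseteq> verts G"
    proof
      fix w assume "w \<in> set vs"
      then obtain i where i: "i < m" "vs ! i = w"
        by (auto simp: in_set_conv_nth m_def)
      then have "w \<in> ends G (h i)" "h i \<in> edges G" using h by auto
      then show "w \<in> verts G" using G by (auto simp: loopless_multigraph_def)
    qed
    ultimately have "is_cycle G vs (map h [0..<m])"
      unfolding is_cycle_def using vs(2) m h by (auto simp: m_def)
    then show False using nc by blast
  qed
qed

lemma loopless_multigraph_edge_subset:
  assumes "loopless_multigraph G" "T \<subseteq> edges G"
  shows "loopless_multigraph (G\<lparr>edges := T\<rparr>)"
  using assms by (auto simp: loopless_multigraph_def intro: finite_subset)

lemma mem_spanning_trees_iff:
  assumes "loopless_multigraph G"
  shows "T \<in> spanning_trees G \<longleftrightarrow> T \<subseteq> edges G \<and>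
    (\<forall>P. (\<forall>e \<in> T. \<not> separates P (ends G e)) \<longrightarrow> (\<forall>u \<in> verts G. \<forall>v \<in> verts G. P u = P v)) \<and>
    (\<forall>e \<in> T. \<exists>P. \<forall>f \<in> T. separates P (ends G f) \<longleftrightarrow> f = e)"
proof (cases "T \<subseteq> edges G")
  case True
  note G = loopless_multigraph_edge_subset[OF assms True]
  show ?thesis
    using True connected_graph_iff_cut[OF G] no_cycle_iff_cut[OF G]
    by (simp add: spanning_trees_def is_tree_def cut_connected_def cut_acyclic_def)
qed (simp add: spanning_trees_def)

lemma
  assumes "loopless_multigraph G" "T \<in> spanning_trees G"
  shows spanning_tree_cut_connected: "(\<And>e. e \<in> T \<Longrightarrow> \<not> separates P (ends G e)) \<Longrightarrow>
      u \<in> verts G \<Longrightarrow> v \<in> verts G \<Longrightarrow> P u = P v"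
    and spanning_tree_edge_cut: "e \<in> T \<Longrightarrow> \<exists>P. \<forall>f \<in> T. separates P (ends G f) \<longleftrightarrow> f = e"
  using assms unfolding mem_spanning_trees_iff[OF assms(1)] by metis+

lemma finite_spanning_trees:
  assumes "loopless_multigraph G"
  shows "finite (spanning_trees G)"
  by (rule finite_subset[of _ "Pow (edges G)"])
    (use assms in \<open>auto simp: spanning_trees_def loopless_multigraph_def\<close>)

section \<open>Adding a path\<close>

locale path_addition =
  fixes G G' :: "('v, 'e) multigraph" and q :: "'v list" and es :: "'e list"
  assumes loopless: "loopless_multigraph G"
    and adds: "adds_path G q es G'"
begin

abbreviation "m \<equiv> length es"

section \<open>Shape of the enlarged graph\<close>

lemma length_q [simp]: "length q = Suc m"
  using adds by (simp add: adds_path_def)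

lemma distinct_q: "distinct q"
  using adds by (auto simp: adds_path_def)

lemma q_nth_eq_iff: "i \<le> m \<Longrightarrow> j \<le> m \<Longrightarrow> q ! i = q ! j \<longleftrightarrow> i = j"
  using distinct_q by (simp add: nth_eq_iff_index_eq)

lemma q_shape:
  obtains a ws b where "q = a # ws @ [b]" "a \<in> verts G" "b \<in> verts G" "a \<noteq> b"
    "set ws \<inter> verts G = {}" "m = Suc (length ws)"
proof -
  obtain a ws b where q: "q = a # ws @ [b]" "a \<in> verts G" "b \<in> verts G" "a \<noteq> b"
    "set ws \<inter> verts G = {}"
    using adds unfolding adds_path_def by blast
  moreover have "m = Suc (length ws)"
    using length_q unfolding q(1) by simp
  ultimately show thesis using that by blast
qed

lemma m_pos: "0 < m"
  using q_shape by force

lemma q_ends_in_verts: "q ! 0 \<in> verts G" "q ! m \<in> verts G"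
  by (rule q_shape; simp add: nth_append)+

lemma q_interior_notin_verts: "0 < i \<Longrightarrow> i < m \<Longrightarrow> q ! i \<notin> verts G"
  by (rule q_shape) (auto simp: nth_append nth_Cons' disjoint_iff)

lemma verts_G': "verts G' = verts G \<union> (\<lambda>i. q ! i) ` {..m}"
proof -
  have "verts G' = verts G \<union> set q"
    using adds by (auto simp: adds_path_def)
  moreover have "set q = (\<lambda>i. q ! i) ` {..m}"
    by (auto simp: set_conv_nth less_Suc_eq_le)
  ultimately show ?thesis by simp
qed

lemma edges_G': "edges G' = edges G \<union> set es"
  and distinct_es: "distinct es"
  and es_disjoint: "set es \<inter> edges G = {}"
  and ends_old [simp]: "e \<in> edges G \<Longrightarrow> ends G' e = ends G e"
  and ends_new [simp]: "i < m \<Longrightarrow> ends G' (es ! i) = {q ! i, q ! Suc i}"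
  using adds by (auto simp: adds_path_def)

lemma es_nth_notin_edges [simp]: "i < m \<Longrightarrow> es ! i \<notin> edges G"
  using es_disjoint by (auto simp: disjoint_iff)

lemma loopless_G': "loopless_multigraph G'"
proof -
  have "ends G' e \<subseteq> verts G' \<and> card (ends G' e) = 2" if e: "e \<in> edges G'" for e
  proof (cases "e \<in> edges G")
    case True
    then show ?thesis
      using loopless by (auto simp: loopless_multigraph_def verts_G')
  next
    case False
    then obtain i where i: "i < m" "e = es ! i"
      using e by (auto simp: edges_G' in_set_conv_nth)
    then have "q ! i \<noteq> q ! Suc i"
      using q_nth_eq_iff by simp
    then show ?thesis
      using i by (auto simp: verts_G')
  qed
  then show ?thesis
    using loopless by (auto simp: loopless_multigraph_def verts_G' edges_G')
qed

text \<open>Only the interior of the path takes its values from \<open>h\<close>; the index chosen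
  by \<open>SOME\<close> is unique there because \<open>q\<close> has no repetitions. The value type
  is left open to serve both colourings and integer potentials.\<close>

definition extend :: "('v \<Rightarrow> 'a) \<Rightarrow> (nat \<Rightarrow> 'a) \<Rightarrow> 'v \<Rightarrow> 'a" where
  "extend f h w = (if w \<in> verts G then f w else h (SOME i. i \<le> m \<and> q ! i = w))"

lemma extend_old [simp]: "w \<in> verts G \<Longrightarrow> extend f h w = f w"
  by (simp add: extend_def)

lemma extend_path:
  assumes "h 0 = f (q ! 0)" "h m = f (q ! m)" "i \<le> m"
  shows "extend f h (q ! i) = h i"
proof (cases "i = 0 \<or> i = m")
  case True
  then show ?thesis using assms q_ends_in_verts by auto
next
  case False
  have "(SOME j. j \<le> m \<and> q ! j = q ! i) = i"
    by (rule some_equality) (use assms(3) q_nth_eq_iff in auto)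
  then show ?thesis
    using False assms(3) q_interior_notin_verts[of i] by (simp add: extend_def)
qed

lemma separates_extend_old:
  assumes "e \<in> edges G"
  shows "separates (extend P h) (ends G e) = separates P (ends G e)"
proof (rule separates_cong)
  fix a assume "a \<in> ends G e"
  then have "a \<in> verts G"
    using assms loopless unfolding loopless_multigraph_def by blast
  then show "extend P h a = P a" by simp
qed

section \<open>Colourings along the path and the trees of the enlarged graph\<close>

lemma constant_on_subpath:
  assumes "a \<le> b" "\<And>l. a \<le> l \<Longrightarrow> l < b \<Longrightarrow> P (q ! l) = P (q ! Suc l)"
  shows "P (q ! a) = P (q ! b)"
  using assms by (induction b rule: dec_induct) auto

lemma constant_on_path:
  "(\<And>l. l < m \<Longrightarrow> P (q ! l) = P (q ! Suc l)) \<Longrightarrow> P (q ! 0) = P (q ! m)"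
  by (rule constant_on_subpath[where P = P]) simp_all

lemma constant_on_verts_G':
  assumes const: "\<forall>u \<in> verts G. \<forall>v \<in> verts G. P u = P v"
    and path: "\<And>l. l \<le> m \<Longrightarrow> P (q ! l) = P (q ! 0) \<or> P (q ! l) = P (q ! m)"
  shows "\<forall>u \<in> verts G'. \<forall>v \<in> verts G'. P u = P v"
proof -
  have "P w = P (q ! 0)" if w: "w \<in> verts G'" for w
  proof (cases "w \<in> verts G")
    case True
    then show ?thesis using const q_ends_in_verts by blast
  next
    case False
    then obtain l where "l \<le> m" "w = q ! l"
      using w by (auto simp: verts_G')
    moreover have "P (q ! m) = P (q ! 0)"
      using const q_ends_in_verts by blast
    ultimately show ?thesis using path by metis
  qed
  then show ?thesis by simp
qed

text \<open>Without \<open>es ! i\<close> the new path falls into two tails that hang from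
  \<open>q ! 0\<close> and \<open>q ! m\<close>; such tails neither close cycles nor connect old
  vertices.\<close>

lemma spanning_tree_avoiding_iff:
  assumes i: "i < m" and T: "T \<subseteq> edges G"
  shows "T \<union> (set es - {es ! i}) \<in> spanning_trees G' \<longleftrightarrow> T \<in> spanning_trees G"
proof -
  define S where "S = T \<union> (set es - {es ! i})"
  have S_cases: "f \<in> T \<or> (\<exists>j. j < m \<and> j \<noteq> i \<and> f = es ! j)" if "f \<in> S" for f
    using that by (auto simp: S_def in_set_conv_nth)
  have esS: "es ! j \<in> S" if "j < m" "j \<noteq> i" for j
    using that i distinct_es by (auto simp: S_def nth_eq_iff_index_eq)
  have TS: "f \<in> T \<Longrightarrow> f \<in> S" for f
    by (simp add: S_def)
  have esT: "es ! j \<noteq> f" if "j < m" "f \<in> T" for j f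
    using that T es_nth_notin_edges by blast
  \<comment> \<open>Each tail inherits the colour of the old vertex it hangs from, so no retained
    new edge is separated.\<close>
  define ext where
    "ext P = extend P (\<lambda>l. if l \<le> i then P (q ! 0) else P (q ! m))" for P :: "'v \<Rightarrow> bool"
  have ext_path: "ext P (q ! l) = (if l \<le> i then P (q ! 0) else P (q ! m))" if "l \<le> m" for P l
    unfolding ext_def by (rule extend_path) (use i that in auto)
  have ext_new: "\<not> separates (ext P) (ends G' (es ! j))" if "j < m" "j \<noteq> i" for P j
    using that by (auto simp: ext_path)
  have ext_T: "separates (ext P) (ends G' f) = separates P (ends G f)" if "f \<in> T" for P f
    using that T by (simp add: ext_def separates_extend_old subset_iff)
  have G'T: "separates P (ends G' f) = separates P (ends G f)" if "f \<in> T" for P f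
    using that T by (simp add: subset_iff)
  show ?thesis
    unfolding S_def[symmetric]
  proof
    assume tree: "S \<in> spanning_trees G'"
    have conn: "\<And>P. (\<forall>e\<in>S. \<not> separates P (ends G' e)) \<Longrightarrow> (\<forall>u\<in>verts G'. \<forall>v\<in>verts G'. P u = P v)"
      by (intro ballI spanning_tree_cut_connected[OF loopless_G' tree]) auto
    have acyc: "\<And>e. e \<in> S \<Longrightarrow> \<exists>P. \<forall>f\<in>S. separates P (ends G' f) \<longleftrightarrow> f = e"
      by (rule spanning_tree_edge_cut[OF loopless_G' tree])
    show "T \<in> spanning_trees G"
      unfolding mem_spanning_trees_iff[OF loopless]
    proof (intro conjI allI impI)
      fix P assume P: "\<forall>e\<in>T. \<not> separates P (ends G e)"
      have "\<forall>e\<in>S. \<not> separates (ext P) (ends G' e)"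
        using S_cases ext_new ext_T P by blast
      then have "\<forall>u\<in>verts G'. \<forall>v\<in>verts G'. ext P u = ext P v"
        by (rule conn)
      moreover have "w \<in> verts G'" "ext P w = P w" if "w \<in> verts G" for w
        using that by (simp_all add: verts_G' ext_def)
      ultimately show "\<forall>u\<in>verts G. \<forall>v\<in>verts G. P u = P v"
        by metis
    next
      show "\<forall>e\<in>T. \<exists>P. \<forall>f\<in>T. separates P (ends G f) \<longleftrightarrow> f = e"
        using acyc TS G'T by metis
    qed (rule T)
  next
    assume tree: "T \<in> spanning_trees G"
    have conn: "\<And>P. (\<forall>e\<in>T. \<not> separates P (ends G e)) \<Longrightarrow> (\<forall>u\<in>verts G. \<forall>v\<in>verts G. P u = P v)"
      by (intro ballI spanning_tree_cut_connected[OF loopless tree]) auto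
    have acyc: "\<And>e. e \<in> T \<Longrightarrow> \<exists>P. \<forall>f\<in>T. separates P (ends G f) \<longleftrightarrow> f = e"
      by (rule spanning_tree_edge_cut[OF loopless tree])
    show "S \<in> spanning_trees G'"
      unfolding mem_spanning_trees_iff[OF loopless_G']
    proof (intro conjI allI impI)
      show "S \<subseteq> edges G'"
        using T by (auto simp: S_def edges_G')
    next
      fix P assume P: "\<forall>e\<in>S. \<not> separates P (ends G' e)"
      have step: "P (q ! l) = P (q ! Suc l)" if "l < m" "l \<noteq> i" for l
      proof -
        have "\<not> separates P (ends G' (es ! l))"
          using P esS[OF that] by blast
        then show ?thesis using that by simp
      qed
      show "\<forall>u\<in>verts G'. \<forall>v\<in>verts G'. P u = P v"
      proof (rule constant_on_verts_G')
        show "\<forall>u\<in>verts G. \<forall>v\<in>verts G. P u = P v"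
          using conn P TS G'T by blast
        fix l assume l: "l \<le> m"
        show "P (q ! l) = P (q ! 0) \<or> P (q ! l) = P (q ! m)"
        proof (cases "l \<le> i")
          case True
          have "P (q ! 0) = P (q ! l)"
            by (rule constant_on_subpath[where P = P], simp, rule step) (use True i in auto)
          then show ?thesis by simp
        next
          case False
          have "P (q ! l) = P (q ! m)"
            by (rule constant_on_subpath[where P = P], rule l, rule step) (use False in auto)
          then show ?thesis by simp
        qed
      qed
    next
      show "\<forall>e\<in>S. \<exists>P. \<forall>f\<in>S. separates P (ends G' f) \<longleftrightarrow> f = e"
      proof
        fix e assume "e \<in> S"
        then consider "e \<in> T" | j where "j < m" "j \<noteq> i" "e = es ! j"
          using S_cases by blast
        then show "\<exists>P. \<forall>f\<in>S. separates P (ends G' f) \<longleftrightarrow> f = e"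
        proof cases
          case 1
          then obtain P where P: "\<forall>f\<in>T. separates P (ends G f) \<longleftrightarrow> f = e"
            using acyc by blast
          have "separates (ext P) (ends G' f) \<longleftrightarrow> f = e" if "f \<in> S" for f
            using S_cases[OF that] P ext_T ext_new esT 1 by blast
          then show ?thesis by blast
        next
          case 2
          \<comment> \<open>This marks the piece of a tail that is cut off from \<open>G\<close> by
            removing \<open>es ! j\<close>: it lies between the edges \<open>j\<close> and
            \<open>i\<close>, on whichever side of \<open>i\<close> the index \<open>j\<close>
            is.\<close>
          define h where "h l \<longleftrightarrow> j < l \<and> l \<le> i \<or> i < l \<and> l \<le> j" for l
          define P where "P = extend (\<lambda>_. False) h"
          have P_path: "P (q ! l) = h l" if "l \<le> m" for l
            unfolding P_def by (rule extend_path) (use 2 i that in \<open>auto simp: h_def\<close>)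
          have "separates P (ends G' f) \<longleftrightarrow> f = e" if "f \<in> S" for f
            using S_cases[OF that]
          proof (elim disjE exE conjE)
            assume f: "f \<in> T"
            then have "\<not> separates P (ends G' f)"
              using T by (simp add: P_def separates_extend_old subset_iff) (simp add: separates_def)
            then show ?thesis using f esT 2 by blast
          next
            fix l assume l: "l < m" "l \<noteq> i" "f = es ! l"
            have "f = e \<longleftrightarrow> l = j"
              using l 2 distinct_es by (simp add: nth_eq_iff_index_eq)
            moreover have "h l \<noteq> h (Suc l) \<longleftrightarrow> l = j"
              using l 2 by (auto simp: h_def)
            ultimately show ?thesis
              using l by (simp add: P_path)
          qed
          then show ?thesis by blast
        qed
      qed
    qed
  qed
qed

text \<open>The whole new path joins the same two vertices as \<open>e\<close>, and replacing an
  edge of a tree by a path through new vertices gives a tree again.\<close>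

lemma spanning_tree_containing_iff:
  assumes e: "e \<in> edges G" "ends G e = {q ! 0, q ! m}" and T: "T \<subseteq> edges G" "e \<notin> T"
  shows "T \<union> set es \<in> spanning_trees G' \<longleftrightarrow> insert e T \<in> spanning_trees G"
proof -
  define S where "S = T \<union> set es"
  have S_cases: "f \<in> T \<or> (\<exists>j. j < m \<and> f = es ! j)" if "f \<in> S" for f
    using that by (auto simp: S_def in_set_conv_nth)
  have esS: "es ! j \<in> S" if "j < m" for j
    using that by (auto simp: S_def)
  have TS: "f \<in> T \<Longrightarrow> f \<in> S" for f
    by (simp add: S_def)
  have esT: "es ! j \<noteq> f" if "j < m" "f \<in> T" for j f
    using that T es_nth_notin_edges by blast
  \<comment> \<open>A change of colour across \<open>e\<close> is moved to the new edge
    \<open>es ! i\<close>. The index \<open>i\<close> is free: any choice serves the old edges, and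
    \<open>i = j\<close> isolates \<open>es ! j\<close>.\<close>
  define ext where
    "ext i P = extend P (\<lambda>l. if l \<le> i then P (q ! 0) else P (q ! m))" for P :: "'v \<Rightarrow> bool" and i
  have ext_path: "ext i P (q ! l) = (if l \<le> i then P (q ! 0) else P (q ! m))"
    if "i < m" "l \<le> m" for P l i
    unfolding ext_def by (rule extend_path) (use that in auto)
  have ext_T: "separates (ext i P) (ends G' f) = separates P (ends G f)" if "f \<in> T" for P f i
    using that T by (simp add: ext_def separates_extend_old subset_iff)
  have ext_new: "separates (ext i P) (ends G' (es ! j)) \<longleftrightarrow> i = j \<and> separates P (ends G e)"
    if "i < m" "j < m" for P i j
    using that by (auto simp: ext_path e)
  have G'T: "separates P (ends G' f) = separates P (ends G f)" if "f \<in> T" for P f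
    using that T by (simp add: subset_iff)
  show ?thesis
    unfolding S_def[symmetric]
  proof
    assume tree: "S \<in> spanning_trees G'"
    have conn: "\<And>P. (\<forall>e\<in>S. \<not> separates P (ends G' e)) \<Longrightarrow> (\<forall>u\<in>verts G'. \<forall>v\<in>verts G'. P u = P v)"
      by (intro ballI spanning_tree_cut_connected[OF loopless_G' tree]) auto
    have acyc: "\<And>e. e \<in> S \<Longrightarrow> \<exists>P. \<forall>f\<in>S. separates P (ends G' f) \<longleftrightarrow> f = e"
      by (rule spanning_tree_edge_cut[OF loopless_G' tree])
    show "insert e T \<in> spanning_trees G"
      unfolding mem_spanning_trees_iff[OF loopless]
    proof (intro conjI allI impI)
      show "insert e T \<subseteq> edges G" using e T by simp
    next
      fix P assume P: "\<forall>e\<in>insert e T. \<not> separates P (ends G e)"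
      have "\<forall>e\<in>S. \<not> separates (ext 0 P) (ends G' e)"
        using S_cases ext_new[OF m_pos] ext_T P by blast
      then have "\<forall>u\<in>verts G'. \<forall>v\<in>verts G'. ext 0 P u = ext 0 P v"
        by (rule conn)
      moreover have "w \<in> verts G'" "ext 0 P w = P w" if "w \<in> verts G" for w
        using that by (simp_all add: verts_G' ext_def)
      ultimately show "\<forall>u\<in>verts G. \<forall>v\<in>verts G. P u = P v"
        by metis
    next
      show "\<forall>g\<in>insert e T. \<exists>P. \<forall>f\<in>insert e T. separates P (ends G f) \<longleftrightarrow> f = g"
      proof
        fix g assume "g \<in> insert e T"
        then consider "g \<in> T" "g \<noteq> e" | "g = e" using T by blast
        then show "\<exists>P. \<forall>f\<in>insert e T. separates P (ends G f) \<longleftrightarrow> f = g"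
        proof cases
          case 1
          then obtain P where P: "\<forall>f\<in>S. separates P (ends G' f) \<longleftrightarrow> f = g"
            using acyc TS by blast
          have "P (q ! l) = P (q ! Suc l)" if "l < m" for l
          proof -
            have "\<not> separates P (ends G' (es ! l))"
              using P esS[OF that] esT[OF that 1(1)] by blast
            then show ?thesis using that by simp
          qed
          then have "P (q ! 0) = P (q ! m)"
            by (rule constant_on_path)
          then have "\<not> separates P (ends G e)" by (simp add: e)
          then have "\<forall>f\<in>insert e T. separates P (ends G f) \<longleftrightarrow> f = g"
            using 1 P TS G'T by blast
          then show ?thesis by blast
        next
          case 2
          \<comment> \<open>The colour changes exactly once along the path, at its first edge, so it
            differs at the two ends, which are those of \<open>e\<close>.\<close>
          obtain P where P: "\<forall>f\<in>S. separates P (ends G' f) \<longleftrightarrow> f = es ! 0"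
            using acyc esS m_pos by blast
          have "P (q ! 0) \<noteq> P (q ! 1)"
          proof -
            have "separates P (ends G' (es ! 0))"
              using P esS[OF m_pos] by blast
            then show ?thesis using m_pos by simp
          qed
          moreover have step: "P (q ! l) = P (q ! Suc l)" if "l < m" "l \<noteq> 0" for l
          proof -
            have "es ! l \<noteq> es ! 0"
              using that m_pos distinct_es by (simp add: nth_eq_iff_index_eq)
            then have "\<not> separates P (ends G' (es ! l))"
              using P esS[OF that(1)] by blast
            then show ?thesis using that by simp
          qed
          have "1 \<le> m" using m_pos by linarith
          then have "P (q ! 1) = P (q ! m)"
            by (rule constant_on_subpath[where P = P]) (rule step, simp_all)
          ultimately have "separates P (ends G e)" by (simp add: e)
          moreover have "\<not> separates P (ends G f)" if "f \<in> T" for f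
            using P TS[OF that] G'T[OF that] esT[OF m_pos that] by metis
          ultimately have "\<forall>f\<in>insert e T. separates P (ends G f) \<longleftrightarrow> f = g"
            using 2 T by blast
          then show ?thesis by blast
        qed
      qed
    qed
  next
    assume tree: "insert e T \<in> spanning_trees G"
    have conn: "\<And>P. (\<forall>f\<in>insert e T. \<not> separates P (ends G f)) \<Longrightarrow>
          (\<forall>u\<in>verts G. \<forall>v\<in>verts G. P u = P v)"
      by (intro ballI spanning_tree_cut_connected[OF loopless tree]) auto
    have acyc: "\<And>g. g \<in> insert e T \<Longrightarrow> \<exists>P. \<forall>f\<in>insert e T. separates P (ends G f) \<longleftrightarrow> f = g"
      by (rule spanning_tree_edge_cut[OF loopless tree])
    show "S \<in> spanning_trees G'"
      unfolding mem_spanning_trees_iff[OF loopless_G']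
    proof (intro conjI allI impI)
      show "S \<subseteq> edges G'"
        using T by (auto simp: S_def edges_G')
    next
      fix P assume P: "\<forall>e\<in>S. \<not> separates P (ends G' e)"
      have step: "P (q ! l) = P (q ! Suc l)" if "l < m" for l
      proof -
        have "\<not> separates P (ends G' (es ! l))"
          using P esS[OF that] by blast
        then show ?thesis using that by simp
      qed
      have path: "P (q ! 0) = P (q ! l)" if "l \<le> m" for l
        by (rule constant_on_subpath[where P = P], simp, rule step) (use that in simp)
      show "\<forall>u\<in>verts G'. \<forall>v\<in>verts G'. P u = P v"
      proof (rule constant_on_verts_G')
        have "\<not> separates P (ends G e)" using path[of m] by (simp add: e)
        then show "\<forall>u\<in>verts G. \<forall>v\<in>verts G. P u = P v"
          using conn P TS G'T by blast
        fix l assume "l \<le> m"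
        then show "P (q ! l) = P (q ! 0) \<or> P (q ! l) = P (q ! m)"
          using path[of l] by simp
      qed
    next
      show "\<forall>g\<in>S. \<exists>P. \<forall>f\<in>S. separates P (ends G' f) \<longleftrightarrow> f = g"
      proof
        fix g assume "g \<in> S"
        then consider "g \<in> T" "g \<noteq> e" | j where "j < m" "g = es ! j"
          using S_cases T by blast
        then show "\<exists>P. \<forall>f\<in>S. separates P (ends G' f) \<longleftrightarrow> f = g"
        proof cases
          case 1
          then obtain P where P: "\<forall>f\<in>insert e T. separates P (ends G f) \<longleftrightarrow> f = g"
            using acyc by blast
          have "separates (ext 0 P) (ends G' f) \<longleftrightarrow> f = g" if "f \<in> S" for f
            using S_cases[OF that]
          proof (elim disjE exE conjE)
            assume "f \<in> T"
            then show ?thesis using P ext_T by simp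
          next
            fix l assume l: "l < m" "f = es ! l"
            have "\<not> separates P (ends G e)" using P 1 by simp
            moreover have "f \<noteq> g" using l esT[OF l(1) 1(1)] by simp
            ultimately show ?thesis using l ext_new[OF m_pos l(1)] by metis
          qed
          then show ?thesis by blast
        next
          case 2
          obtain P where P: "\<forall>f\<in>insert e T. separates P (ends G f) \<longleftrightarrow> f = e"
            using acyc by blast
          have "separates (ext j P) (ends G' f) \<longleftrightarrow> f = g" if "f \<in> S" for f
            using S_cases[OF that]
          proof (elim disjE exE conjE)
            assume f: "f \<in> T"
            have "\<not> separates P (ends G f)" using P f T by auto
            moreover have "f \<noteq> g" using esT[OF 2(1) f] 2(2) by simp
            ultimately show ?thesis using ext_T[OF f] by simp
          next
            fix l assume l: "l < m" "f = es ! l"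
            have "f = g \<longleftrightarrow> j = l"
              using l 2 distinct_es by (auto simp: nth_eq_iff_index_eq)
            moreover have "separates P (ends G e)" using P by simp
            ultimately show ?thesis
              using ext_new[OF 2(1) l(1)] l by metis
          qed
          then show ?thesis by blast
        qed
      qed
    qed
  qed
qed

text \<open>Omitting the edges \<open>i < j\<close> would isolate the segment from
  \<open>q ! Suc i\<close> to \<open>q ! j\<close>; the colouring \<open>P\<close> marks this
  segment.\<close>

lemma spanning_tree_avoids_at_most_one:
  assumes T: "T \<in> spanning_trees G'" and ij: "i < j" "j < m" and i: "es ! i \<notin> T" and j: "es ! j \<notin> T"
  shows False
proof -
  define h where "h l \<longleftrightarrow> i < l \<and> l \<le> j" for l
  define P where "P = extend (\<lambda>_. False) h"
  have P_path: "P (q ! l) = h l" if "l \<le> m" for l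
    unfolding P_def by (rule extend_path) (use ij that in \<open>auto simp: h_def\<close>)
  note T' = T[unfolded mem_spanning_trees_iff[OF loopless_G']]
  have "\<not> separates P (ends G' f)" if f: "f \<in> T" for f
  proof (cases "f \<in> edges G")
    case True
    then show ?thesis
      by (simp add: P_def separates_extend_old) (simp add: separates_def)
  next
    case False
    then have "f \<in> set es"
      using f T' by (auto simp: edges_G')
    then obtain l where l: "l < m" "f = es ! l"
      by (auto simp: in_set_conv_nth)
    then have "l \<noteq> i" "l \<noteq> j" using f i j by auto
    then have "h l = h (Suc l)" by (auto simp: h_def)
    then show ?thesis using l by (simp add: P_path)
  qed
  then have "\<forall>u\<in>verts G'. \<forall>v\<in>verts G'. P u = P v"
    using T' by blast
  moreover have "q ! 0 \<in> verts G'" "q ! j \<in> verts G'"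
    using ij by (auto simp: verts_G')
  ultimately have "P (q ! 0) = P (q ! j)" by blast
  then show False
    using P_path ij by (simp add: h_def)
qed

text \<open>A tree that omits \<open>es ! i\<close> contains all other new edges, hence is
  determined by its old edges. The count is the same for every \<open>i\<close>.\<close>

lemma card_spanning_trees_avoiding:
  assumes i: "i < m"
  shows "card {T \<in> spanning_trees G'. es ! i \<notin> T} = tree_number G"
proof -
  have "bij_betw (\<lambda>T. T \<union> (set es - {es ! i})) (spanning_trees G) {T \<in> spanning_trees G'. es ! i \<notin> T}"
  proof (rule bij_betw_byWitness[where f' = "\<lambda>T. T \<inter> edges G"])
    have sub: "T \<subseteq> edges G" if "T \<in> spanning_trees G" for T
      using that by (simp add: spanning_trees_def)
    show "\<forall>T\<in>spanning_trees G. (T \<union> (set es - {es ! i})) \<inter> edges G = T"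
      using sub es_disjoint by blast
    have eq: "(T \<inter> edges G) \<union> (set es - {es ! i}) = T"
      if T: "T \<in> spanning_trees G'" "es ! i \<notin> T" for T
    proof -
      have "es ! j \<in> T" if "j < m" "j \<noteq> i" for j
        using spanning_tree_avoids_at_most_one[OF T(1), of i j]
          spanning_tree_avoids_at_most_one[OF T(1), of j i] T(2) that i
        by (meson linorder_neqE_nat)
      then have "set es - {es ! i} \<subseteq> T"
        unfolding set_conv_nth by blast
      moreover have "T \<subseteq> edges G \<union> set es"
        using T by (simp add: spanning_trees_def edges_G')
      ultimately show ?thesis using T(2) by blast
    qed
    then show "\<forall>T\<in>{T \<in> spanning_trees G'. es ! i \<notin> T}. (T \<inter> edges G) \<union> (set es - {es ! i}) = T"
      by blast
    show "(\<lambda>T. T \<union> (set es - {es ! i})) ` spanning_trees G \<subseteq> {T \<in> spanning_trees G'. es ! i \<notin> T}"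
      using spanning_tree_avoiding_iff[OF i] sub i es_nth_notin_edges by blast
    show "(\<lambda>T. T \<inter> edges G) ` {T \<in> spanning_trees G'. es ! i \<notin> T} \<subseteq> spanning_trees G"
    proof clarify
      fix T assume "T \<in> spanning_trees G'" "es ! i \<notin> T"
      then show "T \<inter> edges G \<in> spanning_trees G"
        using eq spanning_tree_avoiding_iff[OF i, of "T \<inter> edges G"] by simp
    qed
  qed
  then show ?thesis
    unfolding tree_number_def by (rule bij_betw_same_card[symmetric])
qed

text \<open>The bijection exchanges \<open>e\<close> for the new path. A tree containing the path
  cannot contain \<open>e\<close> too, since together they form a cycle.\<close>

lemma card_spanning_trees_containing:
  assumes e: "e \<in> edges G" "ends G e = {q ! 0, q ! m}"
  shows "card {T \<in> spanning_trees G'. set es \<subseteq> T} = card {T \<in> spanning_trees G. e \<in> T}"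
proof -
  have sub: "T \<subseteq> edges G" if "T \<in> spanning_trees G" for T
    using that by (simp add: spanning_trees_def)
  have sub': "T \<subseteq> edges G \<union> set es" if "T \<in> spanning_trees G'" for T
    using that by (simp add: spanning_trees_def edges_G')
  have fwd: "(T - {e}) \<union> set es \<in> spanning_trees G'" if "T \<in> spanning_trees G" "e \<in> T" for T
    using that spanning_tree_containing_iff[OF e, of "T - {e}"] sub[OF that(1)]
    by (simp add: insert_absorb subset_iff)
  have nin: "e \<notin> T" if T: "T \<in> spanning_trees G'" "set es \<subseteq> T" for T
  proof
    assume eT: "e \<in> T"
    obtain P where P: "\<forall>f\<in>T. separates P (ends G' f) \<longleftrightarrow> f = e"
      using spanning_tree_edge_cut[OF loopless_G' T(1) eT] by blast
    have "P (q ! l) = P (q ! Suc l)" if l: "l < m" for l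
    proof -
      have "es ! l \<in> T" "es ! l \<noteq> e"
        using l T(2) e es_nth_notin_edges by auto
      then have "\<not> separates P (ends G' (es ! l))"
        using P by blast
      then show ?thesis using l by simp
    qed
    then have "P (q ! 0) = P (q ! m)"
      by (rule constant_on_path)
    moreover have "separates P (ends G' e)"
      using P eT by blast
    ultimately show False using e by simp
  qed
  have "bij_betw (\<lambda>T. (T - {e}) \<union> set es)
      {T \<in> spanning_trees G. e \<in> T} {T \<in> spanning_trees G'. set es \<subseteq> T}"
  proof (rule bij_betw_byWitness[where f' = "\<lambda>T. insert e (T \<inter> edges G)"])
    show "\<forall>T\<in>{T \<in> spanning_trees G. e \<in> T}. insert e ((T - {e} \<union> set es) \<inter> edges G) = T"
      using sub es_disjoint e by blast
    have eq: "insert e (T \<inter> edges G) - {e} \<union> set es = T"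
      if "T \<in> spanning_trees G'" "set es \<subseteq> T" for T
      using sub'[OF that(1)] nin[OF that] that(2) by blast
    then show "\<forall>T\<in>{T \<in> spanning_trees G'. set es \<subseteq> T}. insert e (T \<inter> edges G) - {e} \<union> set es = T"
      by blast
    show "(\<lambda>T. T - {e} \<union> set es) ` {T \<in> spanning_trees G. e \<in> T} \<subseteq> {T \<in> spanning_trees G'. set es \<subseteq> T}"
      using fwd by blast
    show "(\<lambda>T. insert e (T \<inter> edges G)) ` {T \<in> spanning_trees G'. set es \<subseteq> T} \<subseteq> {T \<in> spanning_trees G. e \<in> T}"
    proof clarify
      fix T assume T: "T \<in> spanning_trees G'" "set es \<subseteq> T"
      have "T \<inter> edges G \<union> set es = T"
        using sub'[OF T(1)] T(2) by blast
      then have "insert e (T \<inter> edges G) \<in> spanning_trees G"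
        using spanning_tree_containing_iff[OF e, of "T \<inter> edges G"] nin[OF T] T by simp
      then show "insert e (T \<inter> edges G) \<in> spanning_trees G \<and> e \<in> insert e (T \<inter> edges G)"
        by simp
    qed
  qed
  then show ?thesis
    by (rule bij_betw_same_card[symmetric])
qed

lemma tree_number_path_addition:
  assumes e: "e \<in> edges G" "ends G e = {q ! 0, q ! m}"
  shows "tree_number G' = m * tree_number G + card {T \<in> spanning_trees G. e \<in> T}"
proof -
  let ?A = "\<lambda>i. {T \<in> spanning_trees G'. es ! i \<notin> T}"
  let ?B = "{T \<in> spanning_trees G'. set es \<subseteq> T}"
  have fin: "finite (spanning_trees G')"
    by (rule finite_spanning_trees[OF loopless_G'])
  have es_sub: "set es \<subseteq> T \<longleftrightarrow> (\<forall>i<m. es ! i \<in> T)" for T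
    unfolding set_conv_nth by blast
  \<comment> \<open>Classify the trees by the new edge they omit; these \<open>m\<close> classes are
    pairwise disjoint, and the trees that omit none remain.\<close>
  then have "spanning_trees G' = (\<Union>i<m. ?A i) \<union> ?B"
    by blast
  then have "tree_number G' = card ((\<Union>i<m. ?A i) \<union> ?B)"
    by (simp add: tree_number_def)
  also have "\<dots> = card (\<Union>i<m. ?A i) + card ?B"
  proof (rule card_Un_disjoint)
    show "(\<Union>i<m. ?A i) \<inter> ?B = {}"
      unfolding es_sub by blast
  qed (use fin in simp_all)
  also have "card (\<Union>i<m. ?A i) = (\<Sum>i<m. card (?A i))"
  proof (rule card_UN_disjoint)
    show "\<forall>i\<in>{..<m}. \<forall>j\<in>{..<m}. i \<noteq> j \<longrightarrow> ?A i \<inter> ?A j = {}"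
    proof (intro ballI impI)
      fix i j assume "i \<in> {..<m}" "j \<in> {..<m}" "i \<noteq> j"
      then show "?A i \<inter> ?A j = {}"
        using spanning_tree_avoids_at_most_one[of _ i j] spanning_tree_avoids_at_most_one[of _ j i]
        by (cases i j rule: linorder_cases) auto
    qed
  qed (use fin in auto)
  also have "\<dots> = m * tree_number G"
    by (simp add: card_spanning_trees_avoiding)
  finally show ?thesis
    by (simp add: card_spanning_trees_containing[OF e])
qed

end

section \<open>Potentials\<close>

text \<open>The element \<open>a - b\<close>, as a function on the whole vertex type: it vanishes
  off \<open>a\<close> and \<open>b\<close>, so equations with \<open>lap\<close> can be stated for
  all \<open>w\<close>.\<close>

definition dipole :: "'v \<Rightarrow> 'v \<Rightarrow> 'v \<Rightarrow> int" where
  "dipole a b w = of_bool (w = a) - of_bool (w = b)"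

text \<open>The contribution of one edge with end set \<open>S\<close>. Splitting the Laplacian by
  edges turns added edges into added terms.\<close>

definition edge_laplacian :: "'v set \<Rightarrow> ('v \<Rightarrow> int) \<Rightarrow> 'v \<Rightarrow> int" where
  "edge_laplacian S y w = (if w \<in> S then \<Sum>v\<in>S. y w - y v else 0)"

text \<open>Unlike \<^const>\<open>laplacian_map\<close>, this is 0 instead of \<^term>\<open>undefined\<close> outside the vertex set.\<close>

definition lap :: "('v, 'e) multigraph \<Rightarrow> ('v \<Rightarrow> int) \<Rightarrow> 'v \<Rightarrow> int" where
  "lap G y w = (\<Sum>e\<in>edges G. edge_laplacian (ends G e) y w)"

lemma edge_laplacian_doubleton:
  "a \<noteq> b \<Longrightarrow> edge_laplacian {a, b} y w = (y a - y b) * dipole a b w"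
  by (auto simp: edge_laplacian_def dipole_def)

text \<open>Degrees and multiplicities are written as sums over edges, and the sums over vertices
  and edges are exchanged.\<close>

lemma laplacian_map_eq_lap:
  assumes G: "loopless_multigraph G" and w: "w \<in> verts G"
  shows "laplacian_map G y w = lap G y w"
proof -
  have fin: "finite (verts G)" "finite (edges G)"
    using G by (auto simp: loopless_multigraph_def)
  have count: "int (card {e \<in> edges G. Q e}) = (\<Sum>e\<in>edges G. of_bool (Q e))" for Q
    using fin by (simp add: of_bool_def sum.If_cases Int_def)
  have edge: "of_bool (w \<in> ends G e) * y w - (\<Sum>v\<in>verts G. of_bool (ends G e = {w, v}) * y v) =
      edge_laplacian (ends G e) y w" if e: "e \<in> edges G" for e
  proof -
    obtain a b where ab: "ends G e = {a, b}" "a \<noteq> b" "a \<in> verts G" "b \<in> verts G"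
      using loopless_endsE[OF G e] by metis
    have "of_bool (ends G e = {w, v}) * y v =
        (if v = a then of_bool (w = b) * y a else 0) + (if v = b then of_bool (w = a) * y b else 0)" for v
      using ab by (auto simp: doubleton_eq_iff)
    then have "(\<Sum>v\<in>verts G. of_bool (ends G e = {w, v}) * y v) =
        of_bool (w = b) * y a + of_bool (w = a) * y b"
      using ab fin by (simp add: sum.distrib)
    then show ?thesis
      using ab by (auto simp: edge_laplacian_doubleton dipole_def)
  qed
  have "laplacian_map G y w =
      (\<Sum>v\<in>verts G. (if w = v then int (degree_of G w) * y v else 0)) -
      (\<Sum>v\<in>verts G. int (edge_mult G w v) * y v)"
    using w by (simp add: laplacian_map_def laplacian_def left_diff_distrib sum_subtractf
        if_distrib[of "\<lambda>x. x * _"] cong: if_cong)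
  also have "\<dots> = int (degree_of G w) * y w - (\<Sum>v\<in>verts G. int (edge_mult G w v) * y v)"
    using w fin by simp
  also have "\<dots> = (\<Sum>e\<in>edges G. of_bool (w \<in> ends G e) * y w) -
      (\<Sum>v\<in>verts G. \<Sum>e\<in>edges G. of_bool (ends G e = {w, v}) * y v)"
    by (simp add: degree_of_def edge_mult_def count sum_distrib_right)
  also have "(\<Sum>v\<in>verts G. \<Sum>e\<in>edges G. of_bool (ends G e = {w, v}) * y v) =
      (\<Sum>e\<in>edges G. \<Sum>v\<in>verts G. of_bool (ends G e = {w, v}) * y v)"
    by (rule sum.swap)
  finally show ?thesis
    by (simp add: lap_def edge[symmetric] sum_subtractf)
qed

lemma lap_cong:
  assumes "loopless_multigraph G" "\<And>v. v \<in> verts G \<Longrightarrow> y v = z v"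
  shows "lap G y w = lap G z w"
  unfolding lap_def
proof (rule sum.cong)
  fix e assume "e \<in> edges G"
  then obtain a b where "ends G e = {a, b}" "a \<noteq> b" "a \<in> verts G" "b \<in> verts G"
    using loopless_endsE[OF assms(1)] by metis
  then show "edge_laplacian (ends G e) y w = edge_laplacian (ends G e) z w"
    using assms(2) by (simp add: edge_laplacian_doubleton)
qed simp

lemma lap_outside:
  assumes "loopless_multigraph G" "w \<notin> verts G"
  shows "lap G y w = 0"
  unfolding lap_def
  by (rule sum.neutral) (use assms in \<open>auto simp: edge_laplacian_def loopless_multigraph_def\<close>)

lemma sum_dipole:
  assumes "finite V" "a \<in> V" "b \<in> V"
  shows "(\<Sum>w\<in>V. dipole a b w) = 0"
  using assms by (simp add: dipole_def sum_subtractf of_bool_def)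

lemma sum_lap:
  assumes G: "loopless_multigraph G"
  shows "(\<Sum>w\<in>verts G. lap G y w) = 0"
proof -
  have "(\<Sum>w\<in>verts G. edge_laplacian (ends G e) y w) = 0" if "e \<in> edges G" for e
  proof -
    obtain a b where "ends G e = {a, b}" "a \<noteq> b" "a \<in> verts G" "b \<in> verts G"
      using loopless_endsE[OF G \<open>e \<in> edges G\<close>] by metis
    then show ?thesis
      using G sum_dipole[of "verts G" a b]
      by (simp add: edge_laplacian_doubleton loopless_multigraph_def flip: sum_distrib_left)
  qed
  then show ?thesis
    unfolding lap_def by (subst sum.swap) simp
qed

lemma lap_add: "lap G (\<lambda>v. y v + z v) w = lap G y w + lap G z w"
proof -
  have "edge_laplacian S (\<lambda>v. y v + z v) w = edge_laplacian S y w + edge_laplacian S z w" for S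
    by (simp add: edge_laplacian_def sum.distrib sum_subtractf distrib_left)
  then show ?thesis
    by (simp add: lap_def sum.distrib)
qed

text \<open>By linearity \<open>\<rho> / \<tau>\<close> is the effective resistance between \<open>a\<close> and \<open>b\<close>.\<close>

definition potential_drops :: "('v, 'e) multigraph \<Rightarrow> 'v \<Rightarrow> 'v \<Rightarrow> int \<Rightarrow> int \<Rightarrow> bool" where
  "potential_drops G a b \<tau> \<rho> \<longleftrightarrow> (\<forall>t d.
     (\<exists>y. (\<forall>w. lap G y w = t * dipole a b w) \<and> y a - y b = d) \<longleftrightarrow> (\<exists>n. t = n * \<tau> \<and> d = n * \<rho>))"

text \<open>Coordinate sum 0 means degree 0: modulo the image of the Laplacian, the elements of
  degree 0 are the multiples of \<open>a - b\<close>.\<close>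

definition dipole_generates :: "('v, 'e) multigraph \<Rightarrow> 'v \<Rightarrow> 'v \<Rightarrow> bool" where
  "dipole_generates G a b \<longleftrightarrow> (\<forall>x. (\<Sum>w\<in>verts G. x w) = 0 \<longrightarrow>
     (\<exists>c y. \<forall>w\<in>verts G. x w = c * dipole a b w + lap G y w))"

section \<open>Currents along the new path\<close>

context path_addition
begin

text \<open>The net outflow at \<open>w\<close> of a current of strength \<open>r i\<close> on the
  \<open>i\<close>-th new edge.\<close>

abbreviation path_flow :: "(nat \<Rightarrow> int) \<Rightarrow> 'v \<Rightarrow> int" where
  "path_flow r w \<equiv> (\<Sum>i<m. r i * dipole (q ! i) (q ! Suc i) w)"

lemma lap_G': "lap G' y w = lap G y w + path_flow (\<lambda>i. y (q ! i) - y (q ! Suc i)) w"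
proof -
  have "lap G' y w = (\<Sum>e\<in>edges G. edge_laplacian (ends G' e) y w) +
      (\<Sum>e\<in>set es. edge_laplacian (ends G' e) y w)"
    unfolding lap_def edges_G'
    by (rule sum.union_disjoint) (use loopless es_disjoint in \<open>auto simp: loopless_multigraph_def\<close>)
  also have "(\<Sum>e\<in>edges G. edge_laplacian (ends G' e) y w) = lap G y w"
    by (simp add: lap_def)
  also have "(\<Sum>e\<in>set es. edge_laplacian (ends G' e) y w) =
      (\<Sum>i<m. edge_laplacian (ends G' (es ! i)) y w)"
    by (rule sum.reindex_bij_betw[symmetric], rule bij_betw_nth) (use distinct_es in auto)
  also have "\<dots> = path_flow (\<lambda>i. y (q ! i) - y (q ! Suc i)) w"
    by (rule sum.cong) (use q_nth_eq_iff in \<open>auto simp: edge_laplacian_doubleton\<close>)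
  finally show ?thesis .
qed

lemma path_flow_at:
  assumes "l \<le> m"
  shows "path_flow r (q ! l) = (if l < m then r l else 0) - (if 0 < l then r (l - 1) else 0)"
proof -
  have "r i * dipole (q ! i) (q ! Suc i) (q ! l) =
      (if i = l then r i else 0) - (if l = Suc i then r i else 0)" if "i < m" for i
    using that assms q_nth_eq_iff by (auto simp: dipole_def)
  then have "path_flow r (q ! l) = (\<Sum>i<m. (if i = l then r i else 0) - (if l = Suc i then r i else 0))"
    by (intro sum.cong) auto
  also have "\<dots> = (\<Sum>i<m. if i = l then r i else 0) - (\<Sum>i<m. if l = Suc i then r i else 0)"
    by (rule sum_subtractf)
  also have "(\<Sum>i<m. if i = l then r i else 0) = (if l < m then r l else 0)"
    by simp
  also have "(\<Sum>i<m. if l = Suc i then r i else 0) = (if 0 < l then r (l - 1) else 0)"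
    using assms by (cases l) auto
  finally show ?thesis .
qed

lemma path_flow_const: "path_flow (\<lambda>_. c) w = c * dipole (q ! 0) (q ! m) w"
proof -
  have "(\<Sum>i<n. dipole (q ! i) (q ! Suc i) w) = dipole (q ! 0) (q ! n) w" for n
    by (induction n) (auto simp: dipole_def)
  then show ?thesis by (simp flip: sum_distrib_left)
qed

lemma path_flow_shift:
  assumes "j < m"
  shows "path_flow (\<lambda>i. r i - (if i = j then c else 0)) w =
    path_flow r w - c * dipole (q ! j) (q ! Suc j) w"
proof -
  have "(\<Sum>i<m. (if i = j then c else 0) * dipole (q ! i) (q ! Suc i) w) = c * dipole (q ! j) (q ! Suc j) w"
    using assms by (simp add: if_distrib[of "\<lambda>x. x * _"] cong: if_cong)
  then show ?thesis
    by (simp add: left_diff_distrib sum_subtractf)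
qed

lemma sum_path_drops: "(\<Sum>i<n. y (q ! i) - y (q ! Suc i)) = y (q ! 0) - (y (q ! n) :: int)"
  by (induction n) auto

text \<open>A current \<open>R\<close> prescribed along the new path is realised by a potential up to a multiple of
  the dipole at its \<open>j\<close>-th edge, which makes up for the potential difference of the end points.\<close>

lemma lap_extension:
  assumes j: "j < m" and c: "c = (\<Sum>i<m. R i) - (y (q ! 0) - y (q ! m))"
  obtains y' where
    "\<And>w. lap G' y' w + c * dipole (q ! j) (q ! Suc j) w = lap G y w + path_flow R w"
    "y' (q ! j) - y' (q ! Suc j) = R j - c"
proof -
  \<comment> \<open>The prescribed drops exceed the potential difference of the ends by
    \<open>c\<close> in total; this excess is taken off at edge \<open>j\<close>, and
    \<open>h\<close> sums the corrected drops from \<open>q ! 0\<close> on.\<close>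
  define s where "s i = R i - (if i = j then c else 0)" for i
  define h where "h l = y (q ! 0) - (\<Sum>i<l. s i)" for l
  define y' where "y' = extend y h"
  have "(\<Sum>i<m. s i) = (\<Sum>i<m. R i) - c"
    using j by (simp add: s_def sum_subtractf)
  then have "h m = y (q ! m)"
    by (simp add: h_def c)
  then have path: "y' (q ! l) = h l" if "l \<le> m" for l
    unfolding y'_def by (intro extend_path) (use that in \<open>auto simp: h_def\<close>)
  then have drop: "y' (q ! i) - y' (q ! Suc i) = s i" if "i < m" for i
    using that by (simp add: h_def)
  have "lap G' y' w = lap G y w + path_flow s w" for w
    using lap_cong[OF loopless, of y' y] drop by (simp add: lap_G' y'_def)
  then have "lap G' y' w + c * dipole (q ! j) (q ! Suc j) w = lap G y w + path_flow R w" for w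
    unfolding s_def path_flow_shift[OF j] by simp
  moreover have "y' (q ! j) - y' (q ! Suc j) = R j - c"
    using drop[OF j] by (simp add: s_def)
  ultimately show thesis using that by blast
qed

text \<open>By Kirchhoff's law at the interior vertices, the current on the path, less
  \<open>t\<close> at edge \<open>j\<close>, is a constant \<open>r 0\<close>, and
  \<open>- r 0\<close> flows through \<open>G\<close>. So \<open>- r 0 = n * \<tau>\<close>, with
  drop \<open>n * \<rho>\<close> between the ends of the path. Adding the drops along the path gives
  \<open>t\<close>, and \<open>d = r 0 + t\<close>.\<close>

lemma potential_drops_path_addition:
  assumes drops: "potential_drops G (q ! 0) (q ! m) \<tau> \<rho>" and j: "j < m"
  shows "potential_drops G' (q ! j) (q ! Suc j) (int m * \<tau> + \<rho>) (int m * \<tau> + \<rho> - \<tau>)"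
  unfolding potential_drops_def
proof (intro allI iffI; elim exE conjE)
  fix t d y
  assume y: "\<forall>w. lap G' y w = t * dipole (q ! j) (q ! Suc j) w" and d: "y (q ! j) - y (q ! Suc j) = d"
  define r where "r i = y (q ! i) - y (q ! Suc i) - (if i = j then t else 0)" for i
  have balance: "lap G y w + path_flow r w = 0" for w
    using y lap_G'[of y w] unfolding r_def path_flow_shift[OF j] by simp
  have const: "r l = r 0" if "l < m" for l
    using that
  proof (induction l)
    case (Suc l)
    \<comment> \<open>Interior vertices of the path are not in \<open>G\<close>, so the path flow
      alone has to balance there.\<close>
    then have "lap G y (q ! Suc l) = 0"
      by (intro lap_outside[OF loopless] q_interior_notin_verts) auto
    then show ?case
      using balance[of "q ! Suc l"] Suc by (simp add: path_flow_at)
  qed simp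
  have "path_flow r w = path_flow (\<lambda>_. r 0) w" for w
    by (rule sum.cong) (use const in auto)
  then have "lap G y w = (- r 0) * dipole (q ! 0) (q ! m) w" for w
    using balance[of w] by (simp add: path_flow_const)
  then obtain n where n: "- r 0 = n * \<tau>" "y (q ! 0) - y (q ! m) = n * \<rho>"
    using drops unfolding potential_drops_def by blast
  have "(\<Sum>i<m. r i) = y (q ! 0) - y (q ! m) - t"
    using j by (simp add: r_def sum_subtractf sum_path_drops[of y, simplified sum_subtractf])
  moreover have "(\<Sum>i<m. r i) = int m * r 0"
    using const by simp
  ultimately have "t = n * \<rho> - int m * r 0"
    using n(2) by simp
  moreover have "r 0 = - (n * \<tau>)"
    using n(1) by simp
  moreover have "d = r 0 + t"
    using const[OF j] d by (simp add: r_def)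
  ultimately show "\<exists>n. t = n * (int m * \<tau> + \<rho>) \<and> d = n * (int m * \<tau> + \<rho> - \<tau>)"
    by (intro exI[of _ n]) (simp add: algebra_simps)
next
  fix t d n
  assume t: "t = n * (int m * \<tau> + \<rho>)" and d: "d = n * (int m * \<tau> + \<rho> - \<tau>)"
  obtain y where y: "\<And>w. lap G y w = n * \<tau> * dipole (q ! 0) (q ! m) w" "y (q ! 0) - y (q ! m) = n * \<rho>"
    using drops unfolding potential_drops_def by blast
  \<comment> \<open>The constant current \<open>- (n * \<tau>)\<close> on the path cancels the
    dipole of \<open>y\<close> at its ends; the correction this requires at edge \<open>j\<close> is
    exactly \<open>- t\<close>.\<close>
  have c: "- t = (\<Sum>i<m. - (n * \<tau>)) - (y (q ! 0) - y (q ! m))"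
    by (simp add: y t algebra_simps)
  obtain y' where y': "\<And>w. lap G' y' w + - t * dipole (q ! j) (q ! Suc j) w = lap G y w + path_flow (\<lambda>_. - (n * \<tau>)) w"
      "y' (q ! j) - y' (q ! Suc j) = - (n * \<tau>) - - t"
    using lap_extension[OF j c] by blast
  have "lap G' y' w = t * dipole (q ! j) (q ! Suc j) w" for w
    using y'(1)[of w] unfolding path_flow_const by (simp add: y)
  moreover have "y' (q ! j) - y' (q ! Suc j) = d"
    using y'(2) by (simp add: t d algebra_simps)
  ultimately show "\<exists>y. (\<forall>w. lap G' y w = t * dipole (q ! j) (q ! Suc j) w) \<and> y (q ! j) - y (q ! Suc j) = d"
    by blast
qed

lemma sum_verts_G': "(\<Sum>w\<in>verts G'. x w) = (\<Sum>w\<in>verts G. x w) + (\<Sum>l\<in>{0<..<m}. x (q ! l))"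
  for x :: "'v \<Rightarrow> int"
proof -
  have V: "verts G' = verts G \<union> (\<lambda>l. q ! l) ` {0<..<m}"
  proof -
    have "{..m} = {0<..<m} \<union> {0, m}" by auto
    then show ?thesis
      using q_ends_in_verts by (auto simp: verts_G')
  qed
  have inj: "inj_on (\<lambda>l. q ! l) {0<..<m}"
    by (rule inj_onI) (use q_nth_eq_iff in auto)
  have "(\<Sum>w\<in>verts G'. x w) = (\<Sum>w\<in>verts G. x w) + (\<Sum>w\<in>(\<lambda>l. q ! l) ` {0<..<m}. x w)"
    unfolding V
    by (rule sum.union_disjoint)
      (use loopless q_interior_notin_verts in \<open>auto simp: loopless_multigraph_def\<close>)
  then show ?thesis
    by (simp add: sum.reindex[OF inj])
qed

text \<open>A current along the path removes the values of \<open>x\<close> at interior vertices,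
  which leaves an element of degree 0 on \<open>G\<close>. The hypothesis expresses it by the dipole
  of the path's ends, itself a constant current on the path, and \<open>lap_extension\<close> trades
  the total current for a multiple of the dipole at edge \<open>j\<close>.\<close>

lemma dipole_generates_path_addition:
  assumes gen: "dipole_generates G (q ! 0) (q ! m)" and j: "j < m"
  shows "dipole_generates G' (q ! j) (q ! Suc j)"
  unfolding dipole_generates_def
proof (intro allI impI)
  fix x :: "'v \<Rightarrow> int" assume x: "(\<Sum>w\<in>verts G'. x w) = 0"
  \<comment> \<open>Partial sums, starting from \<open>r 0 = 0\<close>, make the outflow
    \<open>r l - r (l - 1)\<close> at \<open>q ! l\<close> equal to
    \<open>x (q ! l)\<close>.\<close>
  define r where "r l = (\<Sum>i\<in>{0<..l}. x (q ! i))" for l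
  have r_Suc: "r (Suc l) = r l + x (q ! Suc l)" for l
  proof -
    have "{0<..Suc l} = insert (Suc l) {0<..l}" by auto
    then show ?thesis by (simp add: r_def)
  qed
  have r_last: "r (m - 1) = (\<Sum>i\<in>{0<..<m}. x (q ! i))"
  proof -
    have "{0<..m - 1} = {0<..<m}" using m_pos by auto
    then show ?thesis by (simp add: r_def)
  qed
  define z where "z w = x w - path_flow r w" for w
  have z_interior: "z (q ! l) = 0" if "0 < l" "l < m" for l
    using that r_Suc[of "l - 1"] by (simp add: z_def path_flow_at)
  have V: "finite (verts G')" using loopless_G' by (simp add: loopless_multigraph_def)
  have "(\<Sum>w\<in>verts G'. path_flow r w) = (\<Sum>i<m. r i * (\<Sum>w\<in>verts G'. dipole (q ! i) (q ! Suc i) w))"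
    by (subst sum.swap) (simp add: sum_distrib_left)
  also have "\<dots> = 0"
    by (rule sum.neutral) (use sum_dipole[OF V] in \<open>auto simp: verts_G'\<close>)
  finally have "(\<Sum>w\<in>verts G'. z w) = 0"
    by (simp add: z_def sum_subtractf x)
  then have "(\<Sum>w\<in>verts G. z w) = 0"
    by (simp add: sum_verts_G' z_interior)
  then obtain t y where ty: "\<And>w. w \<in> verts G \<Longrightarrow> z w = t * dipole (q ! 0) (q ! m) w + lap G y w"
    using gen unfolding dipole_generates_def by blast
  have "z w = t * dipole (q ! 0) (q ! m) w + lap G y w" if w: "w \<in> verts G'" for w
  proof (cases "w \<in> verts G")
    case False
    then obtain l where l: "l \<le> m" "w = q ! l" "l \<noteq> 0" "l \<noteq> m"
      using w q_ends_in_verts unfolding verts_G' by auto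
    then have "dipole (q ! 0) (q ! m) w = 0"
      using q_nth_eq_iff by (simp add: dipole_def)
    then show ?thesis
      using l z_interior[of l] False by (simp add: lap_outside[OF loopless])
  qed (rule ty)
  \<comment> \<open>The dipole of the ends, taken \<open>t\<close> times, is the flow of the
    constant current \<open>t\<close>, which is merged with \<open>r\<close>.\<close>
  then have x_eq: "x w = lap G y w + path_flow (\<lambda>i. r i + t) w" if "w \<in> verts G'" for w
    using that path_flow_const[of t w] by (fastforce simp: z_def distrib_right sum.distrib)
  define c where "c = (\<Sum>i<m. r i + t) - (y (q ! 0) - y (q ! m))"
  obtain y' where "\<And>w. lap G' y' w + c * dipole (q ! j) (q ! Suc j) w = lap G y w + path_flow (\<lambda>i. r i + t) w"
    using lap_extension[OF j c_def] by blast
  then have "\<forall>w\<in>verts G'. x w = c * dipole (q ! j) (q ! Suc j) w + lap G' y' w"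
    by (simp add: x_eq add.commute)
  then show "\<exists>c y. \<forall>w\<in>verts G'. x w = c * dipole (q ! j) (q ! Suc j) w + lap G' y w"
    by blast
qed

end

section \<open>The sandpile group\<close>

lemma vertex_lattice_pow:
  assumes "x \<in> carrier (vertex_lattice G)"
  shows "x [^]\<^bsub>vertex_lattice G\<^esub> (n::nat) = (\<lambda>w\<in>verts G. int n * x w)"
proof (induction n)
  case 0
  then show ?case by (simp add: vertex_lattice_def)
next
  case (Suc n)
  interpret comm_group "vertex_lattice G" by (rule comm_group_vertex_lattice)
  show ?case
    unfolding nat_pow_Suc Suc by (auto simp: vertex_lattice_def fun_eq_iff algebra_simps)
qed

text \<open>Lattice elements are \<open>undefined\<close> off the vertex set whereas
  \<open>lap\<close> accepts any \<open>y\<close>; restricting \<open>y\<close> to the vertices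
  changes no value of \<open>lap\<close>.\<close>

lemma mem_laplacian_image_iff:
  assumes G: "loopless_multigraph G" and x: "x \<in> carrier (vertex_lattice G)"
  shows "x \<in> laplacian_image G \<longleftrightarrow> (\<exists>y. \<forall>w\<in>verts G. x w = lap G y w)"
proof
  assume "x \<in> laplacian_image G"
  then obtain y where "x = laplacian_map G y" by (auto simp: laplacian_image_def)
  then show "\<exists>y. \<forall>w\<in>verts G. x w = lap G y w"
    using laplacian_map_eq_lap[OF G] by blast
next
  assume "\<exists>y. \<forall>w\<in>verts G. x w = lap G y w"
  then obtain y where y: "\<And>w. w \<in> verts G \<Longrightarrow> x w = lap G y w" by blast
  define z where "z = restrict y (verts G)"
  have "x w = laplacian_map G z w" for w
  proof (cases "w \<in> verts G")
    case True
    then show ?thesis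
      using lap_cong[OF G, of y z w] by (simp add: laplacian_map_eq_lap[OF G] y z_def)
  next
    case False
    then show ?thesis
      using x by (auto simp: vertex_lattice_def laplacian_map_def)
  qed
  then have "x = laplacian_map G z" by blast
  moreover have "z \<in> carrier (vertex_lattice G)"
    by (simp add: z_def vertex_lattice_def)
  ultimately show "x \<in> laplacian_image G"
    by (auto simp: laplacian_image_def)
qed

lemma torsion_part_pow: "x [^]\<^bsub>torsion_part A\<^esub> (n::nat) = x [^]\<^bsub>A\<^esub> n"
  by (simp add: torsion_part_def nat_pow_def)

text \<open>The generator is the class \<open>g\<close> of the dipole. Its order is read off from
  \<open>potential_drops\<close>, and \<open>dipole_generates\<close> reaches every torsion class
  because torsion forces degree 0.\<close>

lemma sandpile_group_cyclic:
  assumes G: "loopless_multigraph G" and ab: "a \<in> verts G" "b \<in> verts G"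
    and gen: "dipole_generates G a b" and drops: "potential_drops G a b (int \<tau>) \<rho>" and "0 < \<tau>"
  shows "cyclic_group (sandpile_group G) \<and> order (sandpile_group G) = \<tau>"
proof -
  define A where "A = vertex_lattice G"
  define H where "H = laplacian_image G"
  define Q where "Q = A Mod H"
  define S where "S = sandpile_group G"
  define \<pi> where "\<pi> x = H #>\<^bsub>A\<^esub> x" for x
  define \<delta> where "\<delta> = restrict (dipole a b) (verts G)"
  interpret A: comm_group A
    unfolding A_def by (rule comm_group_vertex_lattice)
  have subH: "subgroup H A"
    unfolding A_def H_def by (rule subgroup_laplacian_image)
  interpret N: normal H A
    by (rule A.subgroup_imp_normal[OF subH])
  interpret S: comm_group S
    unfolding S_def by (rule comm_group_sandpile_group)
  interpret \<pi>: group_hom A Q \<pi>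
    using N.factorgroup_is_group N.r_coset_hom_Mod
    by (simp add: group_hom_def group_hom_axioms_def Q_def \<pi>_def[abs_def])
  have mem_H: "x \<in> H \<longleftrightarrow> (\<exists>y. \<forall>w\<in>verts G. x w = lap G y w)" if "x \<in> carrier A" for x
    using mem_laplacian_image_iff[OF G] that by (simp add: A_def H_def)
  have pow: "x [^]\<^bsub>A\<^esub> n = (\<lambda>w\<in>verts G. int n * x w)" if "x \<in> carrier A" for x and n :: nat
    using vertex_lattice_pow that by (simp add: A_def)
  have \<pi>_one: "\<pi> x = \<one>\<^bsub>Q\<^esub> \<longleftrightarrow> x \<in> H" if "x \<in> carrier A" for x
    using A.coset_join1[OF _ that subH] A.coset_join2[OF that subH] N.subset
    by (auto simp: \<pi>_def Q_def)
  have \<delta>: "\<delta> \<in> carrier A"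
    by (simp add: \<delta>_def A_def vertex_lattice_def)
  have carrier_Q: "carrier Q = \<pi> ` carrier A"
    by (simp add: Q_def \<pi>_def carrier_FactGroup)
  have carrier_S: "carrier S = {Y \<in> carrier Q. \<exists>n::nat. 0 < n \<and> Y [^]\<^bsub>Q\<^esub> n = \<one>\<^bsub>Q\<^esub>}"
    by (simp add: S_def sandpile_group_def torsion_part_def Q_def A_def H_def)
  have one_S: "\<one>\<^bsub>S\<^esub> = \<one>\<^bsub>Q\<^esub>"
    by (simp add: S_def sandpile_group_def torsion_part_def Q_def A_def H_def)
  have pow_S: "Y [^]\<^bsub>S\<^esub> n = Y [^]\<^bsub>Q\<^esub> n" for Y and n :: nat
    by (simp add: S_def sandpile_group_def torsion_part_pow Q_def A_def H_def)
  \<comment> \<open>With the drop \<open>d\<close> left free, \<open>potential_drops\<close> says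
    which multiples of the dipole lie in the image of the Laplacian.\<close>
  have dipole_image: "(\<exists>y. \<forall>w\<in>verts G. t * dipole a b w = lap G y w) \<longleftrightarrow> int \<tau> dvd t" for t
  proof -
    have "t * dipole a b w = lap G y w" if "w \<notin> verts G" for w y
    proof -
      have "w \<noteq> a" "w \<noteq> b" using that ab by auto
      then show ?thesis using lap_outside[OF G that] by (simp add: dipole_def)
    qed
    then have "(\<exists>y. \<forall>w\<in>verts G. t * dipole a b w = lap G y w) \<longleftrightarrow>
        (\<exists>d y. (\<forall>w. lap G y w = t * dipole a b w) \<and> y a - y b = d)"
      by metis
    also have "\<dots> \<longleftrightarrow> int \<tau> dvd t"
      using drops unfolding potential_drops_def dvd_def by (metis mult.commute)
    finally show ?thesis .
  qed
  have \<delta>_pow: "(\<delta> [^]\<^bsub>A\<^esub> n) w = int n * dipole a b w" if "w \<in> verts G" for w and n :: nat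
    unfolding pow[OF \<delta>] using that by (simp add: \<delta>_def)
  define g where "g = \<pi> \<delta>"
  have g_pow: "g [^]\<^bsub>Q\<^esub> n = \<pi> (\<delta> [^]\<^bsub>A\<^esub> n)" for n :: nat
    unfolding g_def by (simp add: \<pi>.hom_nat_pow \<delta>)
  have g_one: "g [^]\<^bsub>Q\<^esub> n = \<one>\<^bsub>Q\<^esub> \<longleftrightarrow> \<tau> dvd n" for n :: nat
  proof -
    have "g [^]\<^bsub>Q\<^esub> n = \<one>\<^bsub>Q\<^esub> \<longleftrightarrow> (\<exists>y. \<forall>w\<in>verts G. (\<delta> [^]\<^bsub>A\<^esub> n) w = lap G y w)"
      using \<delta> by (simp add: g_pow \<pi>_one mem_H)
    also have "\<dots> \<longleftrightarrow> (\<exists>y. \<forall>w\<in>verts G. int n * dipole a b w = lap G y w)"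
      by (simp add: \<delta>_pow)
    finally show ?thesis
      by (simp add: dipole_image)
  qed
  have g: "g \<in> carrier S"
    unfolding carrier_S using g_one[of \<tau>] \<open>0 < \<tau>\<close> \<delta> by (auto simp: g_def)
  have ord: "S.ord g = \<tau>"
    by (simp add: S.ord_unique[OF g] pow_S one_S g_one)
  have "\<exists>n::nat. Y = g [^]\<^bsub>S\<^esub> n" if Y: "Y \<in> carrier S" for Y
  proof -
    obtain x n where x: "x \<in> carrier A" "Y = \<pi> x" and n: "0 < n" "Y [^]\<^bsub>Q\<^esub> (n::nat) = \<one>\<^bsub>Q\<^esub>"
      using Y by (auto simp: carrier_S carrier_Q)
    then have "x [^]\<^bsub>A\<^esub> n \<in> H"
      using \<pi>_one[of "x [^]\<^bsub>A\<^esub> n"] by (simp add: \<pi>.hom_nat_pow)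
    then obtain y where y: "\<And>w. w \<in> verts G \<Longrightarrow> int n * x w = lap G y w"
      using mem_H[of "x [^]\<^bsub>A\<^esub> n"] x by (auto simp: pow)
    \<comment> \<open>A multiple of \<open>x\<close> lies in the image of the Laplacian, where
      coordinates sum to 0; hence \<open>x\<close> has degree 0.\<close>
    have "int n * (\<Sum>w\<in>verts G. x w) = 0"
      using sum_lap[OF G, of y] by (simp add: sum_distrib_left y)
    then have "(\<Sum>w\<in>verts G. x w) = 0"
      using n by simp
    then obtain c y where cy: "\<And>w. w \<in> verts G \<Longrightarrow> x w = c * dipole a b w + lap G y w"
      using gen unfolding dipole_generates_def by blast
    \<comment> \<open>The integer coefficient is reduced to a natural exponent; the difference
      \<open>c - int k\<close> is a multiple of \<open>\<tau>\<close> and so contributes only an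
      element of \<open>H\<close>.\<close>
    define k where "k = nat (c mod int \<tau>)"
    define h where "h = x \<otimes>\<^bsub>A\<^esub> inv\<^bsub>A\<^esub> (\<delta> [^]\<^bsub>A\<^esub> k)"
    have h: "h \<in> carrier A" using x \<delta> by (simp add: h_def)
    have k: "int k = c mod int \<tau>" using \<open>0 < \<tau>\<close> by (simp add: k_def)
    have "h w = (c - int k) * dipole a b w + lap G y w" if "w \<in> verts G" for w
    proof -
      have "\<delta> [^]\<^bsub>A\<^esub> k \<in> carrier (product_group (verts G) (\<lambda>_. integer_group))"
        using A.nat_pow_closed[OF \<delta>] by (simp only: A_def vertex_lattice_def)
      then have "inv\<^bsub>A\<^esub> (\<delta> [^]\<^bsub>A\<^esub> k) = (\<lambda>i\<in>verts G. - (\<delta> [^]\<^bsub>A\<^esub> k) i)"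
        unfolding A_def vertex_lattice_def by (subst inv_product_group) auto
      then have "h w = x w - (\<delta> [^]\<^bsub>A\<^esub> k) w"
        using that by (simp add: h_def A_def vertex_lattice_def)
      then show ?thesis
        using that by (simp add: \<delta>_pow cy algebra_simps)
    qed
    moreover obtain y' where "\<And>w. w \<in> verts G \<Longrightarrow> (c - int k) * dipole a b w = lap G y' w"
    proof -
      have "int \<tau> dvd c - int k" unfolding k by (simp add: dvd_minus_mod)
      then show thesis using dipole_image[of "c - int k"] that by blast
    qed
    ultimately have "h w = lap G (\<lambda>v. y' v + y v) w" if "w \<in> verts G" for w
      using that by (simp add: lap_add)
    then have "h \<in> H" using mem_H[OF h] by blast
    have "x = h \<otimes>\<^bsub>A\<^esub> \<delta> [^]\<^bsub>A\<^esub> k"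
      using x \<delta> by (simp add: h_def A.m_assoc)
    then have "Y = \<pi> h \<otimes>\<^bsub>Q\<^esub> \<pi> (\<delta> [^]\<^bsub>A\<^esub> k)"
      using x h \<delta> by simp
    also have "\<dots> = g [^]\<^bsub>Q\<^esub> k"
      using \<pi>_one[OF h] \<open>h \<in> H\<close> \<delta> g_pow[of k] by simp
    finally show ?thesis by (auto simp: pow_S)
  qed
  then have "carrier S \<subseteq> range (\<lambda>n::int. g [^]\<^bsub>S\<^esub> n)"
    by (metis int_pow_int rangeI subsetI)
  then have range: "carrier S = range (\<lambda>n::int. g [^]\<^bsub>S\<^esub> n)"
    using S.int_pow_closed[OF g] by blast
  then have "cyclic_group S"
    using S.cyclic_group g by blast
  moreover have "order S = \<tau>"
    using S.cyclic_order_is_ord[OF g] S.carrier_subgroup_generated_by_singleton[OF g] range ord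
    by (simp add: order_def)
  ultimately show ?thesis
    by (simp add: S_def)
qed

section \<open>Polygon chains\<close>

text \<open>A single edge has resistance 1, so the drop equals the current.\<close>

lemma potential_drops_edge:
  assumes "a \<noteq> b" "edges G = {e}" "ends G e = {a, b}"
  shows "potential_drops G a b 1 1"
  unfolding potential_drops_def
proof (intro allI)
  fix t d
  have lap: "lap G y w = (y a - y b) * dipole a b w" for y w
    using assms by (simp add: lap_def edge_laplacian_doubleton)
  have "(\<exists>y. (\<forall>w. lap G y w = t * dipole a b w) \<and> y a - y b = d) \<longleftrightarrow> t = d"
  proof
    assume "\<exists>y. (\<forall>w. lap G y w = t * dipole a b w) \<and> y a - y b = d"
    then obtain y where "\<And>w. (y a - y b) * dipole a b w = t * dipole a b w" "y a - y b = d"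
      by (auto simp: lap)
    from this(1)[of a] this(2) show "t = d"
      using assms(1) by (simp add: dipole_def)
  next
    assume "t = d"
    then show "\<exists>y. (\<forall>w. lap G y w = t * dipole a b w) \<and> y a - y b = d"
      using assms(1) by (intro exI[of _ "\<lambda>v. if v = a then d else 0"]) (simp add: lap)
  qed
  then show "(\<exists>y. (\<forall>w. lap G y w = t * dipole a b w) \<and> y a - y b = d) \<longleftrightarrow> (\<exists>n. t = n * 1 \<and> d = n * 1)"
    by auto
qed

lemma dipole_generates_edge:
  assumes "a \<noteq> b" "verts G = {a, b}"
  shows "dipole_generates G a b"
  unfolding dipole_generates_def
proof (intro allI impI)
  fix x :: "'a \<Rightarrow> int" assume "(\<Sum>w\<in>verts G. x w) = 0"
  then have "x b = - x a" using assms by simp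
  moreover have "lap G (\<lambda>_. 0) w = 0" for w
    by (simp add: lap_def edge_laplacian_def cong: if_cong)
  ultimately have "\<forall>w\<in>verts G. x w = x a * dipole a b w + lap G (\<lambda>_. 0) w"
    using assms by (auto simp: dipole_def)
  then show "\<exists>c y. \<forall>w\<in>verts G. x w = c * dipole a b w + lap G y w" by blast
qed

lemma spanning_trees_edge:
  fixes G :: "('v, 'e) multigraph"
  assumes "a \<noteq> b" "verts G = {a, b}" "edges G = {e}" "ends G e = {a, b}"
  shows "spanning_trees G = {{e}}"
proof -
  have G: "loopless_multigraph G"
    using assms by (simp add: loopless_multigraph_def)
  have "\<exists>P :: 'v \<Rightarrow> bool. P a \<noteq> P b" using assms(1) by (intro exI[of _ "\<lambda>v. v = a"]) simp
  then have "T \<in> spanning_trees G \<longleftrightarrow> T = {e}" for T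
    unfolding mem_spanning_trees_iff[OF G] assms(2,3) subset_singleton_iff
    by (auto simp: assms(4))
  then show ?thesis by blast
qed

text \<open>The value \<open>\<tau>(PC\<^bsub>i-1\<^esub>)\<close>, continued by \<open>\<tau>(PC\<^bsub>-1\<^esub>) = 0\<close>.\<close>

definition prev_matching_sum :: "(nat \<Rightarrow> nat) \<Rightarrow> nat \<Rightarrow> int" where
  "prev_matching_sum k i = (case i of 0 \<Rightarrow> 0 | Suc j \<Rightarrow> matching_sum k j)"

text \<open>The convention for index -1 lets one recursion cover \<open>i = 0\<close> as
  well.\<close>

lemma matching_sum_Suc:
  "matching_sum k (Suc i) = int (k (Suc i)) * matching_sum k i - prev_matching_sum k i"
  by (cases i) (simp_all add: prev_matching_sum_def matching_sum_Suc_Suc)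

text \<open>The last conjunct speaks of every neighbouring pair on \<open>p\<close>, since the next
  path may be attached at any of them. The number of trees through the edge and the potential drop
  have the same value, so both obey the same recursion. Positivity of the tree number gives the
  dipole a finite order.\<close>

lemma polygon_chain_path_invariant:
  assumes "polygon_chain_path k i G p"
  shows "loopless_multigraph G \<and> 2 \<le> length p \<and> 0 < tree_number G \<and>
    int (tree_number G) = matching_sum k i \<and>
    (\<forall>j. Suc j < length p \<longrightarrow>
      (\<exists>e \<in> edges G. ends G e = {p ! j, p ! Suc j} \<and>
         int (card {T \<in> spanning_trees G. e \<in> T}) = matching_sum k i - prev_matching_sum k i) \<and>
      potential_drops G (p ! j) (p ! Suc j) (matching_sum k i) (matching_sum k i - prev_matching_sum k i) \<and>
      dipole_generates G (p ! j) (p ! Suc j))"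
  using assms
proof induction
  case (base a b G e)
  have "loopless_multigraph G"
    using base by (simp add: loopless_multigraph_def)
  moreover note spanning_trees_edge[OF base]
  moreover note potential_drops_edge[OF base(1,3,4)] dipole_generates_edge[OF base(1,2)]
  moreover have "{T. T = {e} \<and> e \<in> T} = {{e}}" by auto
  ultimately show ?case
    using base by (simp add: tree_number_def prev_matching_sum_def)
next
  case (step i G p j q es G')
  interpret path_addition G G' q es
    using step by unfold_locales auto
  let ?F = "matching_sum k"
  have "q \<noteq> []" using length_q by (auto simp del: length_q)
  then have q: "p ! j = q ! 0" "p ! Suc j = q ! m"
    using step.hyps(4,5) by (simp_all add: hd_conv_nth last_conv_nth)
  obtain e where e: "e \<in> edges G" "ends G e = {q ! 0, q ! m}"
      "int (card {T \<in> spanning_trees G. e \<in> T}) = ?F i - prev_matching_sum k i"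
    and drops: "potential_drops G (q ! 0) (q ! m) (?F i) (?F i - prev_matching_sum k i)"
    and gen: "dipole_generates G (q ! 0) (q ! m)"
    using step.IH step.hyps(3) unfolding q[symmetric] by blast
  have m: "int m = int (k (Suc i)) - 1"
    using step.hyps(2,6) by simp
  \<comment> \<open>As \<open>m\<close> is one less than the number of sides, both the tree count
    and the first entry of \<open>potential_drops\<close> become the next matching sum.\<close>
  have F: "int m * ?F i + (?F i - prev_matching_sum k i) = ?F (Suc i)"
    unfolding m matching_sum_Suc by (simp add: algebra_simps)
  have prev: "prev_matching_sum k (Suc i) = ?F i"
    by (simp add: prev_matching_sum_def)
  have tree: "int (tree_number G') = ?F (Suc i)"
    using tree_number_path_addition[OF e(1,2)] e(3) step.IH F by simp
  have pos: "0 < tree_number G'"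
    using tree_number_path_addition[OF e(1,2)] step.IH m_pos by simp
  \<comment> \<open>The trees through a new edge are all except those omitting it, which number
    \<open>tree_number G\<close> for each \<open>l\<close>.\<close>
  have card: "int (card {T \<in> spanning_trees G'. es ! l \<in> T}) = ?F (Suc i) - ?F i" if l: "l < m" for l
  proof -
    have fin: "finite (spanning_trees G')"
      by (rule finite_spanning_trees[OF loopless_G'])
    have "spanning_trees G' = {T \<in> spanning_trees G'. es ! l \<in> T} \<union> {T \<in> spanning_trees G'. es ! l \<notin> T}"
      by blast
    then have "tree_number G' = card ({T \<in> spanning_trees G'. es ! l \<in> T} \<union> {T \<in> spanning_trees G'. es ! l \<notin> T})"
      unfolding tree_number_def by (rule arg_cong)
    also have "\<dots> = card {T \<in> spanning_trees G'. es ! l \<in> T} + tree_number G"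
      by (subst card_Un_disjoint) (use fin card_spanning_trees_avoiding[OF l] in auto)
    finally show ?thesis
      using tree step.IH by simp
  qed
  have "(\<exists>e \<in> edges G'. ends G' e = {q ! l, q ! Suc l} \<and>
         int (card {T \<in> spanning_trees G'. e \<in> T}) = ?F (Suc i) - ?F i) \<and>
      potential_drops G' (q ! l) (q ! Suc l) (?F (Suc i)) (?F (Suc i) - ?F i) \<and>
      dipole_generates G' (q ! l) (q ! Suc l)" if "Suc l < length q" for l
  proof (intro conjI bexI)
    have l: "l < m" using that by simp
    show "es ! l \<in> edges G'" "ends G' (es ! l) = {q ! l, q ! Suc l}"
      using l by (simp_all add: edges_G')
    show "int (card {T \<in> spanning_trees G'. es ! l \<in> T}) = ?F (Suc i) - ?F i"
      by (rule card[OF l])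
    show "potential_drops G' (q ! l) (q ! Suc l) (?F (Suc i)) (?F (Suc i) - ?F i)"
      by (rule potential_drops_path_addition[OF drops l, unfolded F])
    show "dipole_generates G' (q ! l) (q ! Suc l)"
      by (rule dipole_generates_path_addition[OF gen l])
  qed
  moreover have "2 \<le> length q"
    using m_pos unfolding length_q by linarith
  ultimately show ?case
    unfolding prev using loopless_G' pos tree by blast
qed

theorem mainTheorem3:
  fixes k :: "nat \<Rightarrow> nat" and n :: nat and PC :: "('v, 'e) multigraph"
  assumes "polygon_chain k n PC"
  shows "cyclic_group (sandpile_group PC) \<and>
    order (sandpile_group PC) = tree_number PC \<and>
    int (tree_number PC) =
      (\<Sum>\<mu> \<in> matchings (path_graph n).
         (-1) ^ card \<mu> * (\<Prod>v \<in> verts (path_graph n) - covered_verts (path_graph n) \<mu>. int (k v)))"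
proof -
  obtain p where "polygon_chain_path k n PC p"
    using assms unfolding polygon_chain_def by blast
  note inv = polygon_chain_path_invariant[OF this]
  then have "Suc 0 < length p" by simp
  with inv obtain e where G: "loopless_multigraph PC" and e: "e \<in> edges PC" "ends PC e = {p ! 0, p ! 1}"
    and drops: "potential_drops PC (p ! 0) (p ! 1) (int (tree_number PC))
      (matching_sum k n - prev_matching_sum k n)"
    and gen: "dipole_generates PC (p ! 0) (p ! 1)"
    by auto
  have "p ! 0 \<in> verts PC" "p ! 1 \<in> verts PC"
    using G e unfolding loopless_multigraph_def by auto
  moreover have "0 < tree_number PC"
    using inv by simp
  ultimately have "cyclic_group (sandpile_group PC) \<and> order (sandpile_group PC) = tree_number PC"
    by (rule sandpile_group_cyclic[OF G _ _ gen drops])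
  then show ?thesis
    using inv by (simp add: matching_sum_def)
qed

end
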